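(* Suppose $q$ is large, and that $1\le x\le\exp(\sqrt{\log q})$. Then $$\max_{q\le|D|\le 2q}\left|\sum_{n\le x}\left(\frac{D}{n}\right)\right|\ge\Psi\left(x,\tfrac13\log q\right),$$ where the maximum is over fundamental discriminants $D$. Consequently, for a fixed real number $B$ there are fundamental discriminants $D$ in the range $q\le|D|\le 2q$ with $$\sum_{n\le x}\left(\frac{D}{n}\right)\ge(\rho(B)+o(1))\,x\gg_B x,\qquad\text{where } x=\left(\tfrac13\log q\right)^B.$$
   Context: $\left(\frac{D}{n}\right)$ is the Kronecker symbol, the real character attached to the fundamental discriminant $D$. $\Psi(x,y)$ is the number of positive integers $n\le x$ all of whose prime factors are at most $y$. $\rho$ is the Dickman function: $\rho(u)=1$ for $0\le u\le1$ and $\rho$ is continuous with $\rho'(u)=-\rho(u-1)/u$ for $u>1$. $o(1)$ refers to $q\to\infty$. *)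

theory Defs
  imports "HOL-Analysis.Analysis" "HOL-Number_Theory.Number_Theory"
    "HOL-Computational_Algebra.Squarefree"
begin

text \<open>The discriminant \<open>1\<close> of the rational field is included.\<close>

definition fundamental_discriminant :: "int \<Rightarrow> bool" where
  "fundamental_discriminant D \<longleftrightarrow>
     (D mod 4 = 1 \<and> squarefree D) \<or>
     (\<exists>m. D = 4 * m \<and> (m mod 4 = 2 \<or> m mod 4 = 3) \<and> squarefree m)"

definition discriminants_between :: "real \<Rightarrow> real \<Rightarrow> int set" where
  "discriminants_between a b =
     {D. fundamental_discriminant D \<and> a \<le> \<bar>real_of_int D\<bar> \<and> \<bar>real_of_int D\<bar> \<le> b}"

lemma finite_discriminants_between: "finite (discriminants_between a b)"
proof (rule finite_subset)
  show "discriminants_between a b \<subseteq> {- \<lfloor>b\<rfloor>..\<lfloor>b\<rfloor>}"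
  proof
    fix D assume "D \<in> discriminants_between a b"
    then have "\<bar>D\<bar> \<le> \<lfloor>b\<rfloor>" by (simp add: discriminants_between_def le_floor_iff)
    then show "D \<in> {- \<lfloor>b\<rfloor>..\<lfloor>b\<rfloor>}" by auto
  qed
qed simp

text \<open>\<open>Legendre D 2\<close> is not the Kronecker symbol at the prime \<open>2\<close>, which
  therefore needs a separate clause.\<close>

definition kronecker_prime :: "int \<Rightarrow> nat \<Rightarrow> int" where
  "kronecker_prime D p =
     (if p = 2 then
        if even D then 0 else if D mod 8 = 1 \<or> D mod 8 = 7 then 1 else -1
      else Legendre D (int p))"

definition kronecker :: "int \<Rightarrow> nat \<Rightarrow> int" where
  "kronecker D n =
     (if n = 0 then if \<bar>D\<bar> = 1 then 1 else 0
      else \<Prod>p\<in>#prime_factorization n. kronecker_prime D p)"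

definition smooth_count :: "real \<Rightarrow> real \<Rightarrow> nat" where
  "smooth_count x y =
     card {n. 1 \<le> n \<and> real n \<le> x \<and> (\<forall>p. prime p \<longrightarrow> p dvd n \<longrightarrow> real p \<le> y)}"

text \<open>The value \<open>0\<close> on the negative half-line only serves to make the function total.
  Existence and uniqueness are shown in \<open>ex1_dickman\<close> below.\<close>

definition is_dickman :: "(real \<Rightarrow> real) \<Rightarrow> bool" where
  "is_dickman f \<longleftrightarrow>
     (\<forall>u<0. f u = 0) \<and> (\<forall>u\<in>{0..1}. f u = 1) \<and> continuous_on {0..} f \<and>
     (\<forall>u>1. (f has_real_derivative - f (u - 1) / u) (at u))"

definition dickman :: "real \<Rightarrow> real" where
  "dickman = (THE f. is_dickman f)"

lemma is_dickman_unique: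
  assumes f: "is_dickman f" and g: "is_dickman g"
  shows "f = g"
proof -
  have eq: "f u = g u" if "u \<le> real n + 1" for n u
    using that
  proof (induction n arbitrary: u)
    case 0
    then show ?case using f g by (cases "u < 0") (auto simp: is_dickman_def)
  next
    case (Suc n)
    show ?case
    proof (cases "u \<le> real n + 1")
      case True
      then show ?thesis by (rule Suc.IH)
    next
      case False
      let ?a = "real n + 1"
      have "(\<lambda>u. f u - g u) u = (\<lambda>u. f u - g u) ?a"
      proof (rule DERIV_isconst2[of ?a u])
        show "continuous_on {?a..u} (\<lambda>u. f u - g u)"
          using f g unfolding is_dickman_def
          by (intro continuous_on_diff; elim conjE) (erule continuous_on_subset, force)+
        fix t assume t: "?a < t" "t < u"
        have "((\<lambda>u. f u - g u) has_real_derivative - f (t - 1) / t - (- g (t - 1) / t)) (at t)"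
          by (rule DERIV_diff) (use f g t in \<open>auto simp: is_dickman_def\<close>)
        moreover have "f (t - 1) = g (t - 1)"
          using t Suc.prems by (intro Suc.IH) auto
        ultimately show "((\<lambda>u. f u - g u) has_real_derivative 0) (at t)" by simp
      qed (use False in auto)
      moreover have "f ?a = g ?a" by (rule Suc.IH) simp
      ultimately show ?thesis by simp
    qed
  qed
  show ?thesis
  proof
    fix u
    obtain n :: nat where "u \<le> real n" using real_arch_simple by blast
    then show "f u = g u" by (intro eq[of _ n]) simp
  qed
qed

definition dickman_step :: "(real \<Rightarrow> real) \<Rightarrow> real \<Rightarrow> real" where
  "dickman_step f u =
     (if u < 0 then 0 else 1 - integral {1..max 1 u} (\<lambda>t. f (t - 1) / t))"

lemma continuous_on_shift_div:
  assumes "continuous_on {0..} f"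
  shows "continuous_on {1..b} (\<lambda>t::real. f (t - 1) / t :: real)"
  by (intro continuous_intros continuous_on_compose2[OF assms]) auto

lemma continuous_on_atLeast:
  fixes f :: "real \<Rightarrow> real"
  assumes "\<And>b. continuous_on {a..b} f"
  shows "continuous_on {a..} f"
  unfolding continuous_on_eq_continuous_within
proof
  fix x assume x: "x \<in> {a..}"
  have "at x within {a..} = at x within {a..x + 1}"
    by (rule at_within_nhd[of x "{..<x + 1}"]) auto
  moreover have "continuous (at x within {a..x + 1}) f"
    using assms[of "x + 1"] x by (auto simp: continuous_on_eq_continuous_within)
  ultimately show "continuous (at x within {a..}) f" by simp
qed

lemma continuous_on_dickman_step:
  assumes "continuous_on {0..} f"
  shows "continuous_on {0..} (dickman_step f)"
proof (rule continuous_on_atLeast)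
  fix b :: real
  have "continuous_on {1..max 1 b} (\<lambda>x. integral {1..x} (\<lambda>t. f (t - 1) / t))"
    by (intro indefinite_integral_continuous_1 integrable_continuous_real
          continuous_on_shift_div assms)
  then have "continuous_on {0..b} (\<lambda>u. integral {1..max 1 u} (\<lambda>t. f (t - 1) / t))"
    by (rule continuous_on_compose2) (auto intro!: continuous_intros)
  then have "continuous_on {0..b} (\<lambda>u. 1 - integral {1..max 1 u} (\<lambda>t. f (t - 1) / t))"
    by (rule continuous_on_diff[OF continuous_on_const])
  then show "continuous_on {0..b} (dickman_step f)"
    by (rule continuous_on_eq) (auto simp: dickman_step_def)
qed

lemma dickman_step_cong:
  assumes "\<And>v. 0 \<le> v \<Longrightarrow> v \<le> u - 1 \<Longrightarrow> f v = g v"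
  shows "dickman_step f u = dickman_step g u"
proof -
  have "integral {1..max 1 u} (\<lambda>t. f (t - 1) / t) = integral {1..max 1 u} (\<lambda>t. g (t - 1) / t)"
  proof (cases "u \<le> 1")
    case False
    then show ?thesis by (intro Henstock_Kurzweil_Integration.integral_cong) (auto simp: assms)
  qed (simp add: max_def)
  then show ?thesis by (simp add: dickman_step_def)
qed

lemma is_dickman_if_fixpoint:
  assumes cont: "continuous_on {0..} f" and fp: "dickman_step f = f"
  shows "is_dickman f"
  unfolding is_dickman_def
proof (intro conjI allI impI ballI)
  fix u :: real assume "u < 0"
  then show "f u = 0" by (subst fp[symmetric]) (simp add: dickman_step_def)
next
  fix u :: real assume "u \<in> {0..1}"
  then show "f u = 1" by (subst fp[symmetric]) (simp add: dickman_step_def max_absorb1)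
next
  fix u :: real assume u: "u > 1"
  let ?g = "\<lambda>t. f (t - 1) / t"
  have "((\<lambda>x. integral {1..x} ?g) has_real_derivative ?g u) (at u within {1..u + 1})"
    by (rule integral_has_real_derivative) (use u continuous_on_shift_div[OF cont] in auto)
  then have "((\<lambda>x. integral {1..x} ?g) has_real_derivative ?g u) (at u)"
    using u by (simp add: at_within_Icc_at)
  then have "((\<lambda>x. 1 - integral {1..x} ?g) has_real_derivative - ?g u) (at u)"
    by (auto intro!: derivative_eq_intros)
  then have "(f has_real_derivative - ?g u) (at u)"
  proof (rule DERIV_cong_ev[THEN iffD1, rotated -1])
    have "eventually (\<lambda>x. x > 1) (nhds u)"
      using u eventually_nhds_in_open[of "{1<..}" u] by simp
    then show "eventually (\<lambda>x. 1 - integral {1..x} ?g = f x) (nhds u)"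
    proof eventually_elim
      case (elim x)
      then show ?case by (subst (2) fp[symmetric]) (simp add: dickman_step_def max_def)
    qed
  qed auto
  then show "(f has_real_derivative - f (u - 1) / u) (at u)" by simp
qed (fact cont)

lemma ex1_dickman: "\<exists>!f. is_dickman f"
proof -
  define F where "F n = (dickman_step ^^ n) (\<lambda>u. if u < 0 then 0 else 1)" for n
  have F_Suc: "F (Suc n) = dickman_step (F n)" for n by (simp add: F_def)
  have contF: "continuous_on {0..} (F n)" for n
  proof (induction n)
    case 0
    show ?case
      by (rule continuous_on_eq[of _ "\<lambda>_. 1"]) (auto simp: F_def)
  qed (simp add: F_Suc continuous_on_dickman_step)
  have stepF: "F (Suc n) u = F n u" if "u \<le> real n + 1" for n u
    using that
  proof (induction n arbitrary: u)
    case 0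
    then show ?case by (simp add: F_def dickman_step_def max_def)
  next
    case (Suc n)
    show ?case
      unfolding F_Suc[of "Suc n"] by (subst F_Suc[of n], rule dickman_step_cong, rule Suc.IH)
        (use Suc.prems in auto)
  qed
  have F_eq: "F m u = F n u" if "n \<le> m" "u \<le> real n + 1" for m n u
    using that by (induction m rule: dec_induct) (auto simp: stepF)
  define f where "f u = F (nat \<lceil>u\<rceil>) u" for u
  have f_eq: "f u = F n u" if "u \<le> real n" for n u
    unfolding f_def by (rule F_eq[symmetric]) (use that in auto, linarith)
  have cont: "continuous_on {0..} f"
  proof (rule continuous_on_atLeast)
    fix b :: real
    obtain n :: nat where n: "b \<le> real n" using real_arch_simple by blast
    have "continuous_on {0..b} (F n)" by (rule continuous_on_subset[OF contF]) auto
    then show "continuous_on {0..b} f"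
      by (rule continuous_on_eq) (use n in \<open>auto simp: f_eq[of _ n]\<close>)
  qed
  have "dickman_step f = f"
  proof
    fix u
    obtain n :: nat where n: "u \<le> real n" using real_arch_simple by blast
    have "dickman_step f u = dickman_step (F n) u"
      by (rule dickman_step_cong) (use n in \<open>auto simp: f_eq[of _ n]\<close>)
    also have "\<dots> = F (Suc n) u" by (simp add: F_Suc)
    also have "\<dots> = f u" by (rule f_eq[symmetric]) (use n in auto)
    finally show "dickman_step f u = f u" .
  qed
  with cont have "is_dickman f" by (rule is_dickman_if_fixpoint)
  then show ?thesis using is_dickman_unique by blast
qed

lemma is_dickman_dickman: "is_dickman dickman"
  unfolding dickman_def by (rule theI'[OF ex1_dickman])

end

theory Submission
  imports Defs "HOL-Real_Asymp.Real_Asymp"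
begin

text \<open>Let \<open>y = (ln q) / 3\<close> and let \<open>P\<close> be \<open>4\<close> times the product of the primes up to \<open>y\<close>.
  Average over the squarefree \<open>D \<equiv> 1 (mod P)\<close> in \<open>[q, 2q]\<close>; these are fundamental discriminants.
  For such \<open>D\<close> the symbol at \<open>n\<close> only depends on the part of \<open>n\<close> composed of primes above
  \<open>y\<close>. It is \<open>1\<close> if \<open>n\<close> is \<open>y\<close>-smooth and nonnegative if all multiplicities in that part are even.
  Otherwise it is, as a function of \<open>D\<close>, a character that sums to \<open>0\<close> over a full period, so that
  after detecting squarefreeness by inclusion-exclusion the sum over \<open>D\<close> is \<open>O(x sqrt q)\<close>.
  By Chebyshev's bound \<open>P \<le> 4 * 4\<^sup>y\<close> the family has more than \<open>x\<^sup>2 sqrt q\<close> elements, so the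
  average of the character sums exceeds \<open>\<Psi>(x, y) - 1\<close>, and integrality gives the first claim.

  The second claim then amounts to \<open>\<Psi>(y\<^sup>B, y) \<sim> \<rho>(B) y\<^sup>B\<close>, which follows by induction on \<open>\<lceil>B\<rceil>\<close>
  from Buchstab's identity. The sum over primes there is compared with the integral of
  \<open>\<rho>(t - 1) / t = - \<rho>'(t)\<close> on a partition with a fixed number of cells, so Mertens' first theorem
  is enough and the integrals over the cells are differences of values of \<open>\<rho>\<close>.\<close>

section \<open>Sums of Legendre symbols over residue classes\<close>

lemma Legendre_cong: "[a = b] (mod p) \<Longrightarrow> Legendre a p = Legendre b p"
  by (simp add: Legendre_def QuadRes_def cong_def)

lemma abs_Legendre_le: "\<bar>Legendre a p\<bar> \<le> 1"
  by (auto simp: Legendre_def)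

lemma Legendre_eq_0_iff: "Legendre a p = 0 \<longleftrightarrow> p dvd a"
  by (auto simp: Legendre_def cong_0_iff)

lemma Legendre_1: "1 < p \<Longrightarrow> Legendre 1 p = 1"
  by (auto simp: Legendre_def QuadRes_def cong_0_iff intro!: exI[of _ 1])

text \<open>Euler's criterion makes both sides congruent modulo \<open>p\<close>. Both lie between
  -1 and 1, so they differ by at most 2, which is less than \<open>p\<close>, and hence they are
  equal.\<close>

lemma Legendre_mult:
  assumes "prime p" "2 < p"
  shows "Legendre (a * b) (int p) = Legendre a (int p) * Legendre b (int p)"
proof -
  have "[Legendre (a * b) (int p) = (a * b) ^ ((p - 1) div 2)] (mod int p)"
    by (rule euler_criterion) (use assms in auto)
  moreover have "[Legendre a (int p) * Legendre b (int p)
      = a ^ ((p - 1) div 2) * b ^ ((p - 1) div 2)] (mod int p)"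
    by (intro cong_mult euler_criterion) (use assms in auto)
  ultimately have "[Legendre (a * b) (int p) = Legendre a (int p) * Legendre b (int p)] (mod int p)"
    by (metis cong_sym cong_trans power_mult_distrib)
  then have dvd: "int p dvd Legendre (a * b) (int p) - Legendre a (int p) * Legendre b (int p)"
    by (simp add: cong_iff_dvd_diff)
  have "\<bar>Legendre (a * b) (int p)\<bar> \<le> 1" "\<bar>Legendre a (int p) * Legendre b (int p)\<bar> \<le> 1"
    using abs_Legendre_le mult_le_one[OF abs_Legendre_le abs_ge_zero abs_Legendre_le] by (auto simp: abs_mult)
  then have "\<bar>Legendre (a * b) (int p) - Legendre a (int p) * Legendre b (int p)\<bar> < int p"
    using assms(2) by linarith
  with dvd show ?thesis
    using zdvd_not_zless[of "\<bar>Legendre (a * b) (int p) - Legendre a (int p) * Legendre b (int p)\<bar>" "int p"]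
    by (cases "Legendre (a * b) (int p) = Legendre a (int p) * Legendre b (int p)") auto
qed

text \<open>Squaring maps the finite set of residues to itself and sends 1 and \<open>p - 1\<close>
  to the same value. It is therefore not injective, hence not surjective, and a value that it misses
  is a nonresidue. That value is not 0 because 0 is a square.\<close>

lemma exists_Legendre_minus_1:
  assumes "prime p" "2 < p"
  shows "\<exists>a. Legendre a (int p) = -1"
proof -
  let ?A = "{0..<int p}" and ?f = "\<lambda>y::int. y ^ 2 mod int p"
  have "\<not> inj_on ?f ?A"
  proof
    assume inj: "inj_on ?f ?A"
    have "(int p - 1) ^ 2 = 1 + int p * (int p - 2)" by (simp add: power2_eq_square algebra_simps)
    then have "?f (int p - 1) = ?f 1" using assms by (metis mod_mult_self2 one_power2)
    then have "int p - 1 = 1" using inj_onD[OF inj, of "int p - 1" 1] assms by auto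
    then show False using assms by simp
  qed
  moreover have "?f ` ?A \<subseteq> ?A" using assms by auto
  ultimately have "?f ` ?A \<noteq> ?A"
    using endo_inj_surj[of ?A ?f] eq_card_imp_inj_on[of ?A ?f] by auto
  then obtain a where a: "a \<in> ?A" "a \<notin> ?f ` ?A" using \<open>?f ` ?A \<subseteq> ?A\<close> by blast
  have "\<not> QuadRes (int p) a"
  proof
    assume "QuadRes (int p) a"
    then obtain y where "y ^ 2 mod int p = a mod int p" by (auto simp: QuadRes_def cong_def)
    then have "?f (y mod int p) = a" using a(1) by (simp add: power_mod)
    moreover have "y mod int p \<in> ?A" using assms by auto
    ultimately show False using a(2) by blast
  qed
  moreover have "a \<noteq> 0"
  proof
    assume "a = 0"
    moreover have "?f 0 \<in> ?f ` ?A" using assms by (intro imageI) auto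
    ultimately show False using a(2) by simp
  qed
  then have "\<not> [a = 0] (mod int p)" using a(1) by (auto simp: cong_def)
  ultimately show ?thesis by (auto simp: Legendre_def)
qed

section \<open>Sums of periodic functions along residue classes\<close>

text \<open>The affine map with slope coprime to \<open>T\<close> permutes the residues modulo
  \<open>T\<close>. Slope 1 gives invariance under shifts; an intercept 0 gives invariance under
  multiplication by a unit, which is what makes a character sum vanish.\<close>

lemma sum_residues_affine:
  fixes f :: "int \<Rightarrow> int"
  assumes T: "T > 0" and per: "\<And>j. f (j mod T) = f j" and cop: "coprime b T"
  shows "(\<Sum>j\<in>{0..<T}. f (c + b * j)) = (\<Sum>j\<in>{0..<T}. f j)"
proof -
  let ?g = "\<lambda>j. (c + b * j) mod T"
  have inj: "inj_on ?g {0..<T}"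
  proof (rule inj_onI)
    fix i j assume ij: "i \<in> {0..<T}" "j \<in> {0..<T}" "?g i = ?g j"
    then have "[b * i = b * j] (mod T)"
      by (metis cong_add_lcancel cong_def)
    then have "[i = j] (mod T)" using cop by (simp add: cong_mult_lcancel)
    then show "i = j" using ij by (simp add: cong_def)
  qed
  moreover have "?g ` {0..<T} \<subseteq> {0..<T}" using T by auto
  ultimately have "bij_betw ?g {0..<T} {0..<T}"
    using endo_inj_surj[of "{0..<T}" ?g] by (auto simp: bij_betw_def)
  then have "(\<Sum>j\<in>{0..<T}. f (?g j)) = (\<Sum>j\<in>{0..<T}. f j)" by (rule sum.reindex_bij_betw)
  then show ?thesis by (simp add: per)
qed

lemma sum_shifted_period:
  fixes f :: "int \<Rightarrow> int"
  assumes T: "T > 0" and per: "\<And>j. f (j mod T) = f j"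
  shows "(\<Sum>j\<in>{a..<a + T}. f j) = (\<Sum>j\<in>{0..<T}. f j)"
proof -
  have "(\<Sum>j\<in>{a..<a + T}. f j) = (\<Sum>j\<in>{0..<T}. f (a + 1 * j))"
    by (rule sum.reindex_bij_witness[of _ "\<lambda>j. a + j" "\<lambda>j. j - a"]) auto
  then show ?thesis using sum_residues_affine[where f = f, OF T per, of 1 a] by simp
qed

text \<open>Full periods contribute 0 and are stripped off the left end until at most
  \<open>T\<close> terms remain, each of absolute value at most 1.\<close>

lemma periodic_sum_bound:
  fixes f :: "int \<Rightarrow> int"
  assumes T: "T > 0" and per: "\<And>j. f (j mod T) = f j" and bd: "\<And>j. \<bar>f j\<bar> \<le> 1"
    and zero: "(\<Sum>j\<in>{0..<T}. f j) = 0"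
  shows "\<bar>\<Sum>j\<in>{a..b}. f j\<bar> \<le> T"
proof (induction "nat (b + 1 - a)" arbitrary: a rule: less_induct)
  case less
  show ?case
  proof (cases "b + 1 - a \<le> T")
    case True
    have "\<bar>\<Sum>j\<in>{a..b}. f j\<bar> \<le> (\<Sum>j\<in>{a..b}. \<bar>f j\<bar>)" by (rule sum_abs)
    also have "\<dots> \<le> (\<Sum>j\<in>{a..b}. 1)" by (intro sum_mono bd)
    also have "\<dots> \<le> T" using True T by simp
    finally show ?thesis .
  next
    case False
    then have "{a..b} = {a..<a + T} \<union> {a + T..b}" using T by auto
    then have "(\<Sum>j\<in>{a..b}. f j) = (\<Sum>j\<in>{a..<a + T}. f j) + (\<Sum>j\<in>{a + T..b}. f j)"
      by (simp only:) (rule sum.union_disjoint, auto)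
    also have "\<dots> = (\<Sum>j\<in>{a + T..b}. f j)"
      using sum_shifted_period[where f = f, OF T per, of a] zero by simp
    finally show ?thesis using less.hyps[of "a + T"] False T by simp
  qed
qed

lemma le_div_iff_int:
  fixes b j m :: int
  assumes "b > 0"
  shows "j \<le> m div b \<longleftrightarrow> j * b \<le> m"
proof
  assume "j \<le> m div b"
  then have "j * b \<le> m div b * b" using assms by (intro mult_right_mono) auto
  also have "\<dots> \<le> m" using assms by (metis mult_div_mod_eq mult.commute pos_mod_sign le_add_same_cancel1)
  finally show "j * b \<le> m" .
next
  assume "j * b \<le> m"
  then have "j * b div b \<le> m div b" using assms by (rule zdiv_mono1)
  then show "j \<le> m div b" using assms by simp
qed

text \<open>A residue class inside an interval is parametrised by consecutive integers. As
  \<open>div\<close> rounds down, the lower end, a quotient rounded up, has to be written as a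
  negated \<open>div\<close>.\<close>

lemma residue_class_Icc:
  fixes b c lo hi :: int
  assumes b: "b > 0"
  shows "bij_betw (\<lambda>j. c + b * j) {- ((c - lo) div b)..(hi - c) div b}
           {D. lo \<le> D \<and> D \<le> hi \<and> [D = c] (mod b)}"
proof (rule bij_betw_imageI)
  show "inj_on (\<lambda>j. c + b * j) {- ((c - lo) div b)..(hi - c) div b}"
    using b by (auto simp: inj_on_def)
  have le1: "lo \<le> c + b * j \<longleftrightarrow> - ((c - lo) div b) \<le> j" for j
  proof -
    have "lo \<le> c + b * j \<longleftrightarrow> - j * b \<le> c - lo" by (simp add: algebra_simps)
    also have "\<dots> \<longleftrightarrow> - j \<le> (c - lo) div b"
      using b by (rule le_div_iff_int[symmetric])
    finally show ?thesis by linarith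
  qed
  have le2: "c + b * j \<le> hi \<longleftrightarrow> j \<le> (hi - c) div b" for j
  proof -
    have "c + b * j \<le> hi \<longleftrightarrow> j * b \<le> hi - c" by (simp add: algebra_simps)
    also have "\<dots> \<longleftrightarrow> j \<le> (hi - c) div b"
      using b by (rule le_div_iff_int[symmetric])
    finally show ?thesis .
  qed
  show "(\<lambda>j. c + b * j) ` {- ((c - lo) div b)..(hi - c) div b}
      = {D. lo \<le> D \<and> D \<le> hi \<and> [D = c] (mod b)}"
  proof (intro equalityI subsetI)
    fix D assume "D \<in> {D. lo \<le> D \<and> D \<le> hi \<and> [D = c] (mod b)}"
    then have D: "lo \<le> D" "D \<le> hi" "b dvd D - c" by (auto simp: cong_iff_dvd_diff)
    then obtain j where j: "D = c + b * j" by (metis dvdE add.commute diff_add_cancel)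
    then show "D \<in> (\<lambda>j. c + b * j) ` {- ((c - lo) div b)..(hi - c) div b}"
      using D le1 le2 by auto
  qed (use le1 le2 in \<open>auto simp: cong_iff_dvd_diff\<close>)
qed

text \<open>The count is a sum of two rounded-down quotients plus 1, so it differs from the ideal
  value by at most 1.\<close>

lemma card_residue_class_Icc:
  fixes b c lo hi :: int
  assumes b: "b > 0" and le: "lo \<le> hi"
  shows "real (card {D. lo \<le> D \<and> D \<le> hi \<and> [D = c] (mod b)}) \<le> (hi - lo) / b + 1"
    and "real (card {D. lo \<le> D \<and> D \<le> hi \<and> [D = c] (mod b)}) \<ge> (hi - lo) / b - 1"
proof -
  have card: "card {D. lo \<le> D \<and> D \<le> hi \<and> [D = c] (mod b)}
      = nat ((hi - c) div b + (c - lo) div b + 1)"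
    using bij_betw_same_card[OF residue_class_Icc[OF b, of c lo hi]] by simp
  have fl: "real_of_int (m div b) \<le> m / b" "real_of_int (m div b) > m / b - 1" for m
    using floor_correct[of "m / b"] by (simp_all add: floor_divide_of_int_eq)
  have eq: "(hi - lo) / b = (hi - c) / b + (c - lo) / b"
    by (simp add: diff_divide_distrib)
  \<comment> \<open>Without this the conversion by \<open>nat\<close> could truncate. The sum of the
    two quotients is an integer greater than -2, hence at least -1.\<close>
  have *: "(hi - c) div b + (c - lo) div b + 1 \<ge> 0"
  proof -
    have "real_of_int ((hi - c) div b + (c - lo) div b) > (hi - lo) / b - 2"
      using fl(2)[of "hi - c"] fl(2)[of "c - lo"] unfolding eq by simp
    moreover have "(hi - lo) / b \<ge> 0" using b le by simp
    ultimately show ?thesis by linarith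
  qed
  show "real (card {D. lo \<le> D \<and> D \<le> hi \<and> [D = c] (mod b)}) \<le> (hi - lo) / b + 1"
    unfolding card eq using fl(1)[of "hi - c"] fl(1)[of "c - lo"] * by simp
  show "real (card {D. lo \<le> D \<and> D \<le> hi \<and> [D = c] (mod b)}) \<ge> (hi - lo) / b - 1"
    unfolding card eq using fl(2)[of "hi - c"] fl(2)[of "c - lo"] * by simp
qed

text \<open>Read along the class as a function of \<open>j\<close>, the summand still has period
  \<open>T\<close> and still sums to 0 over a period, because \<open>b\<close> is invertible modulo
  \<open>T\<close>. The bound depends neither on the interval nor on \<open>b\<close>, so it can be
  used for all moduli of the sieve at once.\<close>

lemma residue_class_sum_bound:
  fixes f :: "int \<Rightarrow> int"
  assumes T: "T > 0" and per: "\<And>j. f (j mod T) = f j" and bd: "\<And>j. \<bar>f j\<bar> \<le> 1"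
    and zero: "(\<Sum>j\<in>{0..<T}. f j) = 0" and b: "b > 0" and cop: "coprime b T"
  shows "\<bar>\<Sum>D | lo \<le> D \<and> D \<le> hi \<and> [D = c] (mod b). f D\<bar> \<le> T"
proof -
  have "(\<Sum>D | lo \<le> D \<and> D \<le> hi \<and> [D = c] (mod b). f D)
      = (\<Sum>j\<in>{- ((c - lo) div b)..(hi - c) div b}. f (c + b * j))"
    by (rule sum.reindex_bij_betw[OF residue_class_Icc[OF b], symmetric])
  moreover have "\<bar>\<Sum>j\<in>{- ((c - lo) div b)..(hi - c) div b}. f (c + b * j)\<bar> \<le> T"
  proof (rule periodic_sum_bound[OF T])
    show "f (c + b * (j mod T)) = f (c + b * j)" for j
      by (metis per mod_add_right_eq mod_mult_right_eq)
    show "(\<Sum>j\<in>{0..<T}. f (c + b * j)) = 0"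
      using sum_residues_affine[where f = f, OF T per cop] zero by simp
  qed (rule bd)
  ultimately show ?thesis by simp
qed

section \<open>Products of Legendre symbols as periodic characters\<close>

text \<open>For odd primes this is the Jacobi symbol with denominator
  \<open>\<Prod>\<^sub># M\<close>. The denominator is kept as a multiset of primes because the
  parity of each multiplicity decides between cancellation and nonnegativity.\<close>

definition legendre_mset :: "nat multiset \<Rightarrow> int \<Rightarrow> int" where
  "legendre_mset M D = (\<Prod>p\<in>#M. Legendre D (int p))"

lemma legendre_mset_simps [simp]:
  "legendre_mset {#} D = 1"
  "legendre_mset (add_mset p M) D = Legendre D (int p) * legendre_mset M D"
  "legendre_mset (M + N) D = legendre_mset M D * legendre_mset N D"
  by (simp_all add: legendre_mset_def)

lemma abs_legendre_mset_le: "\<bar>legendre_mset M D\<bar> \<le> 1"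
proof (induction M)
  case (add p M)
  then show ?case using abs_Legendre_le[of D "int p"] by (simp add: abs_mult mult_le_one)
qed simp

lemma legendre_mset_cong:
  assumes "\<And>p. p \<in># M \<Longrightarrow> [D = E] (mod int p)"
  shows "legendre_mset M D = legendre_mset M E"
  using assms by (induction M) (auto intro: Legendre_cong)

lemma legendre_mset_mult:
  assumes "\<And>p. p \<in># M \<Longrightarrow> prime p \<and> 2 < p"
  shows "legendre_mset M (D * E) = legendre_mset M D * legendre_mset M E"
  using assms by (induction M) (auto simp: Legendre_mult)

lemma legendre_mset_eq_0: "p \<in># M \<Longrightarrow> int p dvd D \<Longrightarrow> legendre_mset M D = 0"
  by (induction M) (auto simp: Legendre_eq_0_iff)

lemma legendre_mset_mod:
  "legendre_mset M (D mod int (\<Prod>\<^sub># M)) = legendre_mset M D"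
proof (rule legendre_mset_cong)
  fix p assume "p \<in># M"
  then have "int p dvd int (\<Prod>\<^sub># M)" by (simp add: dvd_prod_mset)
  then show "[D mod int (\<Prod>\<^sub># M) = D] (mod int p)"
    by (metis cong_def mod_mod_cancel)
qed

lemma legendre_mset_replicate:
  "legendre_mset (replicate_mset k p) D = Legendre D (int p) ^ k"
  by (simp add: legendre_mset_def)

text \<open>Grouping equal primes turns the product into one of even powers.\<close>

lemma legendre_mset_nonneg:
  assumes "\<And>p. p \<in># M \<Longrightarrow> even (count M p)"
  shows "legendre_mset M D \<ge> 0"
proof -
  have "legendre_mset M D = (\<Prod>p\<in>set_mset M. Legendre D (int p) ^ count M p)"
    unfolding legendre_mset_def
  proof (induction M)
    case (add p M)
    show ?case
    proof (cases "p \<in># M")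
      case True
      then show ?thesis using add
        by (simp add: prod.remove[of "set_mset M" p] insert_absorb)
    next
      case False
      then have "count M p = 0" by (simp add: not_in_iff)
      then show ?thesis using False add by (simp cong: prod.cong) (auto intro!: prod.cong)
    qed
  qed simp
  also have "\<dots> \<ge> 0" using assms by (intro prod_nonneg) (auto intro: zero_le_even_power)
  finally show ?thesis .
qed

lemma coprime_if_legendre_mset_nonzero:
  assumes "legendre_mset M a \<noteq> 0" "\<And>p. p \<in># M \<Longrightarrow> prime p"
  shows "coprime a (int (\<Prod>\<^sub># M))"
  using assms
proof (induction M)
  case (add p M)
  then have "coprime (int p) a"
    by (intro prime_imp_coprime) (auto simp: Legendre_eq_0_iff)
  then show ?case using add by (simp add: coprime_commute)
qed simp

lemma prod_mset_primes_pos: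
  assumes "\<And>p. p \<in># M \<Longrightarrow> prime (p::nat)"
  shows "0 < \<Prod>\<^sub># M"
proof -
  have "0 \<notin># M" using assms by fastforce
  then show ?thesis by (simp add: prod_mset_zero_iff zero_less_iff_neq_zero)
qed

text \<open>By the Chinese remainder theorem there is an \<open>a\<close> that is a nonresidue
  modulo \<open>r\<close> and 1 modulo the other primes of \<open>M\<close>. The odd multiplicity of
  \<open>r\<close> gives the symbol the value -1 at \<open>a\<close>. Multiplication by
  \<open>a\<close> permutes the residues and negates the symbol, so the sum equals its own
  negative.\<close>

lemma sum_legendre_mset:
  assumes M: "\<And>p. p \<in># M \<Longrightarrow> prime p \<and> 2 < p" and odd: "odd (count M r)"
  shows "(\<Sum>D\<in>{0..<int (\<Prod>\<^sub># M)}. legendre_mset M D) = 0"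
proof -
  let ?T = "int (\<Prod>\<^sub># M)"
  define N where "N = filter_mset (\<lambda>p. p \<noteq> r) M"
  have r: "prime r" "2 < r" using M[of r] count_inI[of M r] odd by (cases "r \<in># M"; force)+
  have split: "M = replicate_mset (count M r) r + N"
    unfolding N_def by (rule multiset_eqI) auto
  have T: "?T > 0" using M by (simp add: prod_mset_primes_pos)
  obtain g where g: "Legendre g (int r) = -1" using exists_Legendre_minus_1 r by blast
  have "coprime r (\<Prod>\<^sub># N)"
  proof (rule ccontr)
    assume "\<not> coprime r (\<Prod>\<^sub># N)"
    then have "r dvd \<Prod>\<^sub># N" using r(1) prime_imp_coprime by blast
    then obtain p where "p \<in># N" "r dvd p" using r(1) by (auto simp: prime_dvd_prod_mset_iff)
    then show False using M[of p] r(1) primes_dvd_imp_eq[of r p] by (auto simp: N_def)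
  qed
  then have "coprime (int r) (int (\<Prod>\<^sub># N))" by simp
  from binary_chinese_remainder_int[OF this, of g 1] obtain a where
    a: "[a = g] (mod int r)" "[a = 1] (mod int (\<Prod>\<^sub># N))" by blast
  have "legendre_mset N a = legendre_mset N 1"
    by (rule legendre_mset_cong, rule cong_dvd_modulus[OF a(2)]) (simp add: dvd_prod_mset)
  also have "legendre_mset N 1 = 1"
    unfolding legendre_mset_def
    by (rule prod_mset.neutral) (use M in \<open>force simp: N_def intro: Legendre_1\<close>)
  finally have "legendre_mset M a = -1"
    by (subst split) (use Legendre_cong[OF a(1)] g odd in \<open>simp add: legendre_mset_replicate\<close>)
  have cop: "coprime a ?T"
    by (rule coprime_if_legendre_mset_nonzero) (use M \<open>legendre_mset M a = -1\<close> in auto)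
  have "(\<Sum>D\<in>{0..<?T}. legendre_mset M D) = (\<Sum>D\<in>{0..<?T}. legendre_mset M (0 + a * D))"
    by (rule sum_residues_affine[where f = "legendre_mset M", OF T legendre_mset_mod cop, symmetric])
  also have "\<dots> = - (\<Sum>D\<in>{0..<?T}. legendre_mset M D)"
    using M \<open>legendre_mset M a = -1\<close> by (simp add: legendre_mset_mult sum_negf)
  finally show ?thesis by simp
qed

section \<open>Squarefree integers in a residue class\<close>

text \<open>The sum is the expansion of a product of factors \<open>- 1 + 1\<close> over
  \<open>A\<close>.\<close>

lemma sum_Pow_alternating:
  assumes "finite A"
  shows "(\<Sum>S\<in>Pow A. (-1) ^ card S :: int) = (if A = {} then 1 else 0)"
proof -
  have "(\<Prod>x\<in>A. - 1 + 1 :: int) = (\<Sum>S\<in>Pow A. (\<Prod>x\<in>S. -1) * (\<Prod>x\<in>A - S. 1))"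
    by (rule prod_add) (rule assms)
  then show ?thesis using assms by (simp add: power_0_left)
qed

lemma prod_prime_square_dvd_iff:
  fixes D :: int
  assumes "finite S" "\<And>p. p \<in> S \<Longrightarrow> prime p"
  shows "(int (\<Prod>S))\<^sup>2 dvd D \<longleftrightarrow> (\<forall>p\<in>S. (int p)\<^sup>2 dvd D)"
  using assms
proof (induction S rule: finite_induct)
  case (insert p S)
  have "coprime p (\<Prod>S)"
    using insert by (intro prod_coprime_right) (auto intro: primes_coprime)
  then have "coprime ((int p)\<^sup>2) ((int (\<Prod>S))\<^sup>2)" by (simp del: of_nat_prod)
  then have "(int p)\<^sup>2 * (int (\<Prod>S))\<^sup>2 dvd D \<longleftrightarrow> (int p)\<^sup>2 dvd D \<and> (int (\<Prod>S))\<^sup>2 dvd D"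
    by (meson divides_mult dvd_mult_left dvd_mult_right)
  then show ?case using insert by (simp add: power_mult_distrib del: of_nat_prod)
qed simp

lemma squarefree_int_iff:
  fixes D :: int
  assumes "D \<noteq> 0"
  shows "squarefree D \<longleftrightarrow> (\<forall>p::nat. prime p \<longrightarrow> \<not> (int p)\<^sup>2 dvd D)"
proof
  assume "squarefree D"
  then show "\<forall>p::nat. prime p \<longrightarrow> \<not> (int p)\<^sup>2 dvd D"
    using squarefreeD[of D] by (metis int_dvd_int_iff not_prime_unit of_nat_1)
next
  assume *: "\<forall>p::nat. prime p \<longrightarrow> \<not> (int p)\<^sup>2 dvd D"
  show "squarefree D"
  proof (rule squarefreeI)
    fix x assume x: "x\<^sup>2 dvd D"
    show "x dvd 1"
    proof (rule ccontr)
      assume "\<not> x dvd 1"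
      then have "nat \<bar>x\<bar> \<noteq> 1" by auto
      then obtain p where p: "prime p" "p dvd nat \<bar>x\<bar>" using prime_factor_nat by blast
      then have "int p dvd x" by simp
      then have "(int p)\<^sup>2 dvd D" using x by (meson dvd_power_same dvd_trans)
      then show False using * p by blast
    qed
  qed
qed

text \<open>This is the identity expressing squarefreeness as the sum of the Moebius function over
  all d whose square divides \<open>D\<close>, each squarefree d being encoded by its set of primes.
  The admissible \<open>S\<close> are exactly the subsets of the set of primes whose squares divide
  \<open>D\<close>, and the alternating sum vanishes unless that set is empty.\<close>

lemma sum_squarefree_indicator:
  fixes D :: int
  assumes D: "D \<noteq> 0" and Q: "finite Q" "\<And>p. p \<in> Q \<Longrightarrow> prime p"
    and complete: "\<And>p. prime p \<Longrightarrow> (int p)\<^sup>2 dvd D \<Longrightarrow> p \<in> Q"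
  shows "(\<Sum>S | S \<subseteq> Q \<and> (int (\<Prod>S))\<^sup>2 dvd D. (-1) ^ card S) = (if squarefree D then 1 else (0::int))"
proof -
  let ?A = "{p \<in> Q. (int p)\<^sup>2 dvd D}"
  have "{S. S \<subseteq> Q \<and> (int (\<Prod>S))\<^sup>2 dvd D} = Pow ?A"
  proof -
    have "(int (\<Prod>S))\<^sup>2 dvd D \<longleftrightarrow> (\<forall>p\<in>S. (int p)\<^sup>2 dvd D)" if "S \<subseteq> Q" for S
      using that Q finite_subset by (intro prod_prime_square_dvd_iff) auto
    then show ?thesis by blast
  qed
  moreover have "squarefree D \<longleftrightarrow> ?A = {}"
    using D Q(2) complete by (auto simp: squarefree_int_iff)
  ultimately show ?thesis using Q(1) by (simp add: sum_Pow_alternating)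
qed

text \<open>By unique factorization a set of primes is recovered from its product, so the sets
  inject into the positive integers up to \<open>N\<close>. This limits the number of terms in the
  sieve.\<close>

lemma card_prime_sets_prod_le:
  assumes "finite Q" "\<And>p. p \<in> Q \<Longrightarrow> prime (p::nat)"
  shows "card {S. S \<subseteq> Q \<and> \<Prod>S \<le> N} \<le> N"
proof -
  have "inj_on (\<lambda>S. \<Prod>S) {S. S \<subseteq> Q \<and> \<Prod>S \<le> N}"
  proof (rule inj_on_inverseI)
    fix S assume "S \<in> {S. S \<subseteq> Q \<and> \<Prod>S \<le> N}"
    then have S: "finite S" "\<forall>p\<in>S. prime p" using assms by (auto intro: finite_subset)
    have "prime_factors (\<Prod>S) = \<Union> ((\<lambda>p. prime_factors p) ` S)"
    proof -
      have "0 \<notin> S" using S(2) by auto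
      then show ?thesis using prime_factors_prod[OF S(1), of "\<lambda>p. p"] by simp
    qed
    also have "\<dots> = S" using S(2) by (auto simp: prime_prime_factors)
    finally show "prime_factors (\<Prod>S) = S" .
  qed
  moreover have "(\<lambda>S. \<Prod>S) ` {S. S \<subseteq> Q \<and> \<Prod>S \<le> N} \<subseteq> {1..N}"
  proof clarify
    fix S assume S: "S \<subseteq> Q" "\<Prod>S \<le> N"
    then have "\<Prod>S > 0" using assms(2) by (intro prod_pos) (auto simp: prime_gt_0_nat)
    then show "\<Prod>S \<in> {1..N}" using S by simp
  qed
  ultimately have "card {S. S \<subseteq> Q \<and> \<Prod>S \<le> N} \<le> card {1..N}"
    by (rule card_inj_on_le) simp
  then show ?thesis by simp
qed

text \<open>For \<open>d\<close> coprime to \<open>P\<close> the two congruences merge into one by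
  the Chinese remainder theorem. Otherwise a common nonunit divisor of \<open>d\<close> and
  \<open>P\<close> would divide both \<open>D\<close> and \<open>D - 1\<close>.\<close>

lemma residue_class_square_multiples:
  fixes d P lo hi :: int
  shows "{D. lo \<le> D \<and> D \<le> hi \<and> [D = 1] (mod P) \<and> d\<^sup>2 dvd D} = {} \<or>
    coprime d P \<and> (\<exists>c. {D. lo \<le> D \<and> D \<le> hi \<and> [D = 1] (mod P) \<and> d\<^sup>2 dvd D}
       = {D. lo \<le> D \<and> D \<le> hi \<and> [D = c] (mod P * d\<^sup>2)})"
proof (cases "coprime d P")
  case True
  then have cop: "coprime P (d\<^sup>2)" by (simp add: coprime_commute)
  obtain c where c: "[c = 1] (mod P)" "[c = 0] (mod d\<^sup>2)"
    using binary_chinese_remainder_int[OF cop, of 1 0] by blast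
  have "[D = c] (mod P * d\<^sup>2) \<longleftrightarrow> [D = 1] (mod P) \<and> d\<^sup>2 dvd D" for D
  proof -
    have "[D = c] (mod P * d\<^sup>2) \<longleftrightarrow> [D = c] (mod P) \<and> [D = c] (mod d\<^sup>2)"
      using coprime_cong_mult[OF _ _ cop, of D c] cong_modulus_mult cong_dvd_modulus
      by (metis dvd_triv_left dvd_triv_right)
    then show ?thesis using c by (metis cong_0_iff cong_sym cong_trans)
  qed
  then show ?thesis using True by auto
next
  case False
  have "\<not> ([D = 1] (mod P) \<and> d\<^sup>2 dvd D)" for D
  proof
    assume *: "[D = 1] (mod P) \<and> d\<^sup>2 dvd D"
    obtain g where g: "g dvd d" "g dvd P" "\<not> is_unit g" using False by (rule not_coprimeE)
    have "g dvd D" using * g(1) by (meson dvd_trans dvd_power pos2)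
    moreover have "g dvd D - 1" using * g(2) by (meson cong_iff_dvd_diff dvd_trans)
    ultimately have "g dvd 1" by (metis dvd_diff_right_iff dvd_diffD1 dvd_diff diff_diff_eq2 add_diff_cancel_left')
    then show False using g(3) by simp
  qed
  then show ?thesis by auto
qed

lemma finite_int_between [simp]:
  "finite {D::int. lo \<le> D \<and> D \<le> hi \<and> R D}"
  by (rule finite_subset[of _ "{lo..hi}"]) auto

text \<open>If a prime of \<open>M\<close> divides \<open>d\<close>, then every symbol in the sum is
  0. If none does, the modulus \<open>P * d\<^sup>2\<close> is coprime to the period of the symbol,
  and the bound for a single residue class applies.\<close>

lemma square_multiples_sum_bound:
  fixes d P lo hi :: int
  assumes M: "\<And>p. p \<in># M \<Longrightarrow> prime p \<and> 2 < p \<and> coprime (int p) P" and odd: "odd (count M r)"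
    and P: "P > 0" and d: "d > 0"
  shows "\<bar>\<Sum>D | lo \<le> D \<and> D \<le> hi \<and> [D = 1] (mod P) \<and> d\<^sup>2 dvd D. legendre_mset M D\<bar> \<le> int (\<Prod>\<^sub># M)"
proof -
  let ?G = "{D. lo \<le> D \<and> D \<le> hi \<and> [D = 1] (mod P) \<and> d\<^sup>2 dvd D}" and ?T = "int (\<Prod>\<^sub># M)"
  have T: "?T > 0" using M by (simp add: prod_mset_primes_pos)
  show ?thesis
  proof (cases "\<exists>p\<in>#M. int p dvd d")
    case True
    then obtain p where p: "p \<in># M" "int p dvd d" by blast
    have "legendre_mset M D = 0" if "D \<in> ?G" for D
    proof (rule legendre_mset_eq_0[OF p(1)])
      have "d dvd D" using that by (auto intro: dvd_trans[of d "d\<^sup>2"])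
      then show "int p dvd D" using p(2) by (rule dvd_trans[rotated])
    qed
    then show ?thesis using T by simp
  next
    case False
    have cop: "coprime b ?T" if "\<And>p. p \<in># M \<Longrightarrow> coprime b (int p)" for b
      using that by (induction M) (auto simp: coprime_mult_right_iff)
    have "coprime (P * d\<^sup>2) ?T"
    proof (rule cop)
      fix p assume p: "p \<in># M"
      then have "coprime (int p) d" using M False by (intro prime_imp_coprime) auto
      then show "coprime (P * d\<^sup>2) (int p)"
        using M[OF p] by (simp add: coprime_commute)
    qed
    then have *: "\<bar>\<Sum>D | lo \<le> D \<and> D \<le> hi \<and> [D = c] (mod P * d\<^sup>2). legendre_mset M D\<bar> \<le> ?T" for c
      by (intro residue_class_sum_bound T abs_legendre_mset_le legendre_mset_mod sum_legendre_mset[OF _ odd])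
        (use M P d in auto)
    from residue_class_square_multiples[of lo hi P d] show ?thesis
    proof (elim disjE conjE exE)
      assume "?G = {}"
      then show ?thesis using T by (simp only: sum.empty)
    qed (use * in simp)
  qed
qed

lemma square_dvd_imp_le:
  fixes d D :: int
  assumes "d\<^sup>2 dvd D" "0 < D" "D \<le> (int N)\<^sup>2"
  shows "d \<le> int N"
proof -
  have "d\<^sup>2 \<le> (int N)\<^sup>2" using assms zdvd_imp_le by fastforce
  then show ?thesis by (rule power2_le_imp_le) simp
qed

text \<open>Squarefreeness is detected by the alternating sum over prime sets, and the order of
  summation is exchanged. Sets with product above \<open>N\<close> contribute nothing, since the
  square of the product exceeds \<open>hi\<close>; at most \<open>N\<close> sets remain, each
  contributing at most the period.\<close>

lemma squarefree_class_sum_bound: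
  fixes P lo hi :: int
  assumes M: "\<And>p. p \<in># M \<Longrightarrow> prime p \<and> 2 < p \<and> coprime (int p) P" and odd: "odd (count M r)"
    and P: "P > 0" and lo: "0 < lo" and hi: "hi \<le> (int N)\<^sup>2"
  shows "\<bar>\<Sum>D | lo \<le> D \<and> D \<le> hi \<and> [D = 1] (mod P) \<and> squarefree D. legendre_mset M D\<bar>
    \<le> int N * int (\<Prod>\<^sub># M)"
proof -
  let ?T = "int (\<Prod>\<^sub># M)" and ?\<chi> = "legendre_mset M"
  let ?G = "{D. lo \<le> D \<and> D \<le> hi \<and> [D = 1] (mod P)}"
  define Q where "Q = {p::nat. prime p \<and> p \<le> N}"
  have Q: "finite Q" "\<And>p. p \<in> Q \<Longrightarrow> prime p" by (auto simp: Q_def)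
  have pos: "\<Prod>S > 0" if "S \<subseteq> Q" for S
    using that Q(2) by (intro prod_pos) (auto simp: prime_gt_0_nat)
  have finG: "finite ?G" by simp
  have "(\<Sum>D | lo \<le> D \<and> D \<le> hi \<and> [D = 1] (mod P) \<and> squarefree D. ?\<chi> D)
      = (\<Sum>D\<in>?G. if squarefree D then ?\<chi> D else 0)"
    by (subst sum.inter_filter[symmetric, OF finG], rule sum.cong) auto
  also have "\<dots> = (\<Sum>D\<in>?G. \<Sum>S\<in>Pow Q. if (int (\<Prod>S))\<^sup>2 dvd D then (-1) ^ card S * ?\<chi> D else 0)"
  proof (rule sum.cong[OF refl])
    fix D assume D: "D \<in> ?G"
    have "(\<Sum>S\<in>Pow Q. if (int (\<Prod>S))\<^sup>2 dvd D then (-1) ^ card S * ?\<chi> D else 0)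
        = (\<Sum>S | S \<subseteq> Q \<and> (int (\<Prod>S))\<^sup>2 dvd D. (-1) ^ card S * ?\<chi> D)"
      using Q(1) by (subst sum.inter_filter[symmetric]) (auto intro: sum.cong)
    also have "\<dots> = (\<Sum>S | S \<subseteq> Q \<and> (int (\<Prod>S))\<^sup>2 dvd D. (-1) ^ card S) * ?\<chi> D"
      by (simp add: sum_distrib_right)
    also have "(\<Sum>S | S \<subseteq> Q \<and> (int (\<Prod>S))\<^sup>2 dvd D. (-1) ^ card S) = (if squarefree D then 1 else (0::int))"
    proof (rule sum_squarefree_indicator[OF _ Q])
      fix p :: nat assume "prime p" "(int p)\<^sup>2 dvd D"
      then show "p \<in> Q" using square_dvd_imp_le[of "int p" D N] D lo hi by (simp add: Q_def)
    qed (use D lo in auto)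
    finally show "(if squarefree D then ?\<chi> D else 0)
      = (\<Sum>S\<in>Pow Q. if (int (\<Prod>S))\<^sup>2 dvd D then (-1) ^ card S * ?\<chi> D else 0)" by simp
  qed
  also have "\<dots> = (\<Sum>S\<in>Pow Q. \<Sum>D\<in>?G. if (int (\<Prod>S))\<^sup>2 dvd D then (-1) ^ card S * ?\<chi> D else 0)"
    by (rule sum.swap)
  also have "\<dots> = (\<Sum>S\<in>Pow Q. (-1) ^ card S *
      (\<Sum>D | lo \<le> D \<and> D \<le> hi \<and> [D = 1] (mod P) \<and> (int (\<Prod>S))\<^sup>2 dvd D. ?\<chi> D))"
    by (rule sum.cong[OF refl], subst sum.inter_filter[symmetric, OF finG])
      (auto simp: sum_distrib_left conj_assoc intro!: sum.cong)
  also have "\<bar>\<dots>\<bar> \<le> (\<Sum>S\<in>Pow Q. if \<Prod>S \<le> N then ?T else 0)"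
  proof (rule order_trans[OF sum_abs sum_mono])
    fix S assume S: "S \<in> Pow Q"
    let ?H = "{D. lo \<le> D \<and> D \<le> hi \<and> [D = 1] (mod P) \<and> (int (\<Prod>S))\<^sup>2 dvd D}"
    have "\<bar>(-1) ^ card S * (\<Sum>D\<in>?H. ?\<chi> D)\<bar> = \<bar>\<Sum>D\<in>?H. ?\<chi> D\<bar>"
      by (simp add: abs_mult power_abs)
    also have "\<dots> \<le> (if \<Prod>S \<le> N then ?T else 0)"
    proof (cases "\<Prod>S \<le> N")
      case True
      have "\<bar>\<Sum>D\<in>?H. ?\<chi> D\<bar> \<le> ?T"
        by (rule square_multiples_sum_bound[OF M odd P]) (use pos[of S] S in \<open>auto simp del: of_nat_prod\<close>)
      then show ?thesis using True by simp
    next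
      case False
      have "?H = {}"
      proof (rule ccontr)
        assume "?H \<noteq> {}"
        then obtain D where D: "lo \<le> D" "D \<le> hi" "(int (\<Prod>S))\<^sup>2 dvd D" by blast
        then have "int (\<Prod>S) \<le> int N" using lo hi by (intro square_dvd_imp_le[of _ D]) auto
        then show False using False by linarith
      qed
      then have "\<bar>\<Sum>D\<in>?H. ?\<chi> D\<bar> = 0" by (simp only: sum.empty abs_zero)
      then show ?thesis using False by simp
    qed
    finally show "\<bar>(-1) ^ card S * (\<Sum>D\<in>?H. ?\<chi> D)\<bar> \<le> (if \<Prod>S \<le> N then ?T else 0)" .
  qed
  also have "\<dots> = int (card {S. S \<subseteq> Q \<and> \<Prod>S \<le> N}) * ?T"
    using Q(1) by (subst sum.inter_filter[symmetric]) (auto simp: Pow_def)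
  also have "\<dots> \<le> int N * ?T"
    using card_prime_sets_prod_le[OF Q, of N] by (intro mult_right_mono) auto
  finally show ?thesis .
qed

text \<open>The terms are compared with a telescoping series. Starting at 3 is what brings the bound
  down to 1/2, so that a sieve by these squares leaves a positive proportion.\<close>

lemma sum_inverse_squares_le:
  "(\<Sum>d = 3..N. 1 / (real d)\<^sup>2) \<le> 1 / 2"
proof -
  \<comment> \<open>The subtracted tail makes the induction go through; for \<open>N < 3\<close> the
    sum is empty.\<close>
  have "(\<Sum>d = 3..N. 1 / (real d)\<^sup>2) \<le> 1 / 2 - (if N < 3 then 0 else 1 / real N)"
  proof (induction N)
    case (Suc N)
    show ?case
    proof (cases "N < 3")
      case True
      then consider "N < 2" | "N = 2" by linarith
      then show ?thesis by cases (auto simp: numeral_eq_Suc)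
    next
      case False
      have "1 / (real (Suc N))\<^sup>2 \<le> 1 / real N - 1 / real (Suc N)"
        proof -
        have "1 / real N - 1 / real (Suc N) = 1 / (real N * real (Suc N))"
          using False by (simp add: field_simps)
        also have "\<dots> \<ge> 1 / (real (Suc N))\<^sup>2"
          using False by (intro divide_left_mono) (auto simp: power2_eq_square)
        finally show ?thesis .
      qed
      then show ?thesis using Suc False by (simp add: sum.cl_ivl_Suc)
    qed
  qed simp
  moreover have "(if N < 3 then 0 else 1 / real N) \<ge> 0" by simp
  ultimately show ?thesis by linarith
qed

text \<open>A member that is not squarefree is divisible by the square of some prime between 3 and
  \<open>N\<close>; the prime 2 is excluded since an even modulus makes all members odd. The union
  bound removes at most half of the main term and at most \<open>N\<close> further elements from
  rounding.\<close>

lemma card_squarefree_class: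
  fixes P lo hi :: int
  assumes P: "P > 0" "even P" and lo: "0 < lo" "lo \<le> hi" and hi: "hi \<le> (int N)\<^sup>2"
  shows "real (card {D. lo \<le> D \<and> D \<le> hi \<and> [D = 1] (mod P) \<and> squarefree D})
    \<ge> (hi - lo) / (2 * P) - 1 - N"
proof -
  let ?F = "{D. lo \<le> D \<and> D \<le> hi \<and> [D = 1] (mod P) \<and> squarefree D}"
  let ?G = "{D. lo \<le> D \<and> D \<le> hi \<and> [D = 1] (mod P)}"
  let ?H = "\<lambda>d::nat. {D. lo \<le> D \<and> D \<le> hi \<and> [D = 1] (mod P) \<and> (int d)\<^sup>2 dvd D}"
  have "?G \<subseteq> ?F \<union> (\<Union>d\<in>{3..N}. ?H d)"
  proof
    fix D assume D: "D \<in> ?G"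
    show "D \<in> ?F \<union> (\<Union>d\<in>{3..N}. ?H d)"
    proof (cases "squarefree D")
      case False
      then obtain p :: nat where p: "prime p" "(int p)\<^sup>2 dvd D"
        using squarefree_int_iff[of D] D lo by auto
      have "p \<le> N" using square_dvd_imp_le[OF p(2), of N] D lo hi by simp
      moreover have "p \<noteq> 2"
      proof
        assume "p = 2"
        then have "even D" using p(2) by (auto intro: dvd_trans[of 2 4])
        moreover have "even (D - 1)"
          using D P(2) dvd_trans[of 2 P "D - 1"] by (simp add: cong_iff_dvd_diff del: even_diff)
        ultimately show False by simp
      qed
      ultimately have "p \<in> {3..N}" using prime_ge_2_nat[OF p(1)] by simp
      then show ?thesis using D p(2) by blast
    qed (use D in auto)
  qed
  then have "card ?G \<le> card (?F \<union> (\<Union>d\<in>{3..N}. ?H d))" by (intro card_mono) auto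
  moreover have "card (?F \<union> (\<Union>d\<in>{3..N}. ?H d)) \<le> card ?F + card (\<Union>d\<in>{3..N}. ?H d)"
    by (rule card_Un_le)
  moreover have "card (\<Union>d\<in>{3..N}. ?H d) \<le> (\<Sum>d = 3..N. card (?H d))" by (rule card_UN_le) simp
  ultimately have "card ?G \<le> card ?F + (\<Sum>d = 3..N. card (?H d))" by linarith
  then have "real (card ?G) \<le> real (card ?F + (\<Sum>d = 3..N. card (?H d)))"
    by (simp only: of_nat_le_iff)
  then have "real (card ?G) \<le> real (card ?F) + (\<Sum>d = 3..N. real (card (?H d)))"
    by (simp only: of_nat_add of_nat_sum)
  also have "(\<Sum>d = 3..N. real (card (?H d))) \<le> (\<Sum>d = 3..N. (hi - lo) / P * (1 / (real d)\<^sup>2) + 1)"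
  proof (rule sum_mono)
    fix d assume d: "d \<in> {3..N}"
    from residue_class_square_multiples[of lo hi P "int d"]
    show "real (card (?H d)) \<le> (hi - lo) / P * (1 / (real d)\<^sup>2) + 1"
    proof (elim disjE conjE exE)
      assume "?H d = {}"
      then have "real (card (?H d)) = 0" by (simp only: card.empty of_nat_0)
      moreover have "0 \<le> (hi - lo) / P * (1 / (real d)\<^sup>2)"
        using lo P by (intro mult_nonneg_nonneg divide_nonneg_nonneg) auto
      ultimately show ?thesis by linarith
    next
      fix c assume c: "?H d = {D. lo \<le> D \<and> D \<le> hi \<and> [D = c] (mod P * (int d)\<^sup>2)}"
      have "P * (int d)\<^sup>2 > 0" using P d by simp
      from card_residue_class_Icc(1)[OF this lo(2), of c] show ?thesis unfolding c by simp
    qed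
  qed
  also have "\<dots> = (hi - lo) / P * (\<Sum>d = 3..N. 1 / (real d)\<^sup>2) + real (N - 2)"
    by (simp add: sum.distrib sum_distrib_left)
  also have "\<dots> \<le> (hi - lo) / P * (1 / 2) + N"
    using lo P by (intro add_mono mult_left_mono sum_inverse_squares_le) auto
  finally have upper: "real (card ?G) \<le> real (card ?F) + ((hi - lo) / P * (1 / 2) + N)" by simp
  have lower: "real (card ?G) \<ge> (hi - lo) / P - 1"
    by (rule card_residue_class_Icc) (use lo P in auto)
  define K where "K = (hi - lo) / P"
  have "(hi - lo) / (2 * P) = K / 2" by (simp add: K_def)
  then show ?thesis using upper lower unfolding K_def[symmetric] by linarith
qed

section \<open>Chebyshev and Mertens bounds\<close>

lemma finite_nat_le_real: "finite {n::nat. R n \<and> real n \<le> y}"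
  by (rule finite_subset[of _ "{..nat \<lfloor>y\<rfloor>}"]) (auto simp: le_nat_floor)

definition primorial :: "real \<Rightarrow> nat" where
  "primorial y = \<Prod>{p. prime p \<and> real p \<le> y}"

lemma primorial_pos: "primorial y > 0"
  unfolding primorial_def by (rule prod_pos) (auto simp: prime_gt_0_nat)

lemma prod_primes_dvd:
  fixes n :: nat
  assumes "finite S" "\<And>p. p \<in> S \<Longrightarrow> prime p \<and> p dvd n"
  shows "\<Prod>S dvd n"
  using assms
proof (induction S rule: finite_induct)
  case (insert p S)
  have "coprime p (\<Prod>S)"
    using insert by (intro prod_coprime_right) (auto intro: primes_coprime)
  then show ?case using insert by (simp add: divides_mult)
qed simp

lemma le_nat_floor_iff: "y \<ge> 0 \<Longrightarrow> n \<le> nat \<lfloor>y\<rfloor> \<longleftrightarrow> real n \<le> y"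
  by (metis le_nat_floor of_nat_floor of_nat_le_iff order_trans)

lemma primorial_floor: "y \<ge> 0 \<Longrightarrow> primorial y = primorial (real (nat \<lfloor>y\<rfloor>))"
  by (simp only: primorial_def of_nat_le_iff le_nat_floor_iff)

text \<open>The coefficient occurs twice in a row whose total is \<open>2 * 4 ^ m\<close>.\<close>

lemma binomial_odd_middle_le: "(2 * m + 1) choose m \<le> 4 ^ m"
proof -
  have "2 * ((2 * m + 1) choose m) = ((2 * m + 1) choose m) + ((2 * m + 1) choose (m + 1))"
    using binomial_symmetric[of m "2 * m + 1"] by simp
  also have "\<dots> = (\<Sum>k\<in>{m, m + 1}. (2 * m + 1) choose k)" by simp
  also have "\<dots> \<le> (\<Sum>k\<le>2 * m + 1. (2 * m + 1) choose k)" by (intro sum_mono2) auto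
  also have "\<dots> = 2 * 4 ^ m" by (subst choose_row_sum) (simp add: power_mult)
  finally show ?thesis by simp
qed

text \<open>This is the induction of Erdos. An even \<open>n > 2\<close> adds no prime, and for
  \<open>n = 2 * m + 1\<close> the primes above \<open>m + 1\<close> are absorbed by a central
  binomial coefficient.\<close>

lemma primorial_nat_le: "primorial (real n) \<le> 4 ^ n"
proof (induction n rule: less_induct)
  case (less n)
  have "n = 0 \<or> n = 1 \<or> n = 2 \<or> n > 2" by linarith
  then consider "n = 0" | "n = 1" | "n = 2" | "n > 2" "even n" | m where "m \<ge> 1" "n = 2 * m + 1"
    by (cases "even n") (auto elim!: oddE)
  then show ?case
  proof cases
    case 1
    have "{p. prime p \<and> real p \<le> real n} = {}" using 1 by auto
    then show ?thesis by (simp only: primorial_def) simp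
  next
    case 2
    have "{p. prime p \<and> real p \<le> real n} = {}" using 2 by (auto dest: prime_gt_1_nat)
    then show ?thesis by (simp only: primorial_def) simp
  next
    case 3
    have "{p. prime p \<and> real p \<le> real n} = {2}" using 3 by (auto dest: prime_ge_2_nat intro: le_antisym)
    then show ?thesis using 3 by (simp only: primorial_def) simp
  next
    case 4
    have "{p. prime p \<and> real p \<le> real n} = {p. prime p \<and> real p \<le> real (n - 1)}"
    proof (intro Collect_cong conj_cong refl)
      fix p :: nat assume "prime p"
      then have "p \<noteq> n" using 4 prime_odd_nat by blast
      then show "(real p \<le> real n) = (real p \<le> real (n - 1))" by auto
    qed
    then have "primorial (real n) = primorial (real (n - 1))" by (simp only: primorial_def)
    also have "\<dots> \<le> 4 ^ (n - 1)" using 4 by (intro less.IH) auto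
    also have "\<dots> \<le> 4 ^ n" by (intro power_increasing) auto
    finally show ?thesis .
  next
    case (5 m)
    let ?B = "{p. prime p \<and> m + 1 < p \<and> p \<le> 2 * m + 1}"
    have split: "{p. prime p \<and> real p \<le> real n} = {p. prime p \<and> real p \<le> real (m + 1)} \<union> ?B"
      using 5 by auto
    have "primorial (real n) = primorial (real (m + 1)) * \<Prod>?B"
      unfolding primorial_def split by (rule prod.union_disjoint) (auto intro: finite_nat_le_real)
    also have "\<dots> \<le> 4 ^ (m + 1) * 4 ^ m"
    proof (rule mult_le_mono)
      show "primorial (real (m + 1)) \<le> 4 ^ (m + 1)" using 5 by (intro less.IH) auto
      \<comment> \<open>Each such prime divides the factorial of \<open>2 * m + 1\<close> but
        neither of the factorials of \<open>m\<close> and \<open>m + 1\<close>.\<close>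
      have "\<Prod>?B dvd (2 * m + 1) choose m"
      proof (rule prod_primes_dvd)
        fix p assume "p \<in> ?B"
        then have p: "prime p" "m + 1 < p" "p \<le> 2 * m + 1" by auto
        have "fact m * fact (m + 1) * ((2 * m + 1) choose m) = (fact (2 * m + 1) :: nat)"
          using binomial_fact_lemma[of m "2 * m + 1"] by (simp add: Suc_diff_le)
        moreover have "p dvd fact (2 * m + 1)" by (subst prime_dvd_fact_iff) (use p in auto)
        ultimately have "p dvd fact m * fact (m + 1) * ((2 * m + 1) choose m)" by metis
        then show "prime p \<and> p dvd (2 * m + 1) choose m"
          using p by (auto simp only: prime_dvd_mult_iff prime_dvd_fact_iff)
      qed simp
      then have "\<Prod>?B \<le> (2 * m + 1) choose m" by (rule dvd_imp_le) simp
      also have "\<dots> \<le> 4 ^ m" by (rule binomial_odd_middle_le)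
      finally show "\<Prod>?B \<le> 4 ^ m" .
    qed
    also have "\<dots> = 4 ^ n" using 5 by (simp add: power_add[symmetric])
    finally show ?thesis .
  qed
qed

lemma sum_ln_primes_le:
  assumes "y \<ge> 0"
  shows "(\<Sum>p | prime p \<and> real p \<le> y. ln (real p)) \<le> y * ln 4"
proof -
  have "(\<Sum>p | prime p \<and> real p \<le> y. ln (real p)) = ln (real (primorial y))"
    unfolding primorial_def
    by (subst of_nat_prod, rule ln_prod[symmetric]) (auto intro: finite_nat_le_real simp: prime_gt_0_nat)
  also have "\<dots> \<le> ln (real (4 ^ nat \<lfloor>y\<rfloor>))"
  proof (rule ln_mono)
    show "real (primorial y) \<le> real (4 ^ nat \<lfloor>y\<rfloor>)"
      unfolding primorial_floor[OF assms] of_nat_le_iff by (rule primorial_nat_le)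
  qed (simp_all add: primorial_pos)
  also have "\<dots> = real (nat \<lfloor>y\<rfloor>) * ln 4" by (simp add: ln_realpow)
  also have "\<dots> \<le> y * ln 4" using assms by (intro mult_right_mono) auto
  finally show ?thesis .
qed

text \<open>Divided by 3, this constant becomes the exponent 7/15 in the bound for the modulus. It
  follows from \<open>ln 2 \<le> 25 / 36\<close>.\<close>

lemma ln_4_le: "ln 4 \<le> (7 / 5 :: real)"
proof -
  have "ln (4::real) = 2 * ln 2" using ln_realpow[of 2 2] by simp
  then show ?thesis using ln2_le_25_over_36 by simp
qed

lemma primorial_le_powr:
  assumes "y \<ge> 0"
  shows "real (primorial y) \<le> 4 powr y"
proof -
  have "real (primorial y) \<le> real (4 ^ nat \<lfloor>y\<rfloor>)"
    unfolding primorial_floor[OF assms] of_nat_le_iff by (rule primorial_nat_le)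
  also have "\<dots> = 4 powr real (nat \<lfloor>y\<rfloor>)" by (simp add: powr_realpow)
  also have "\<dots> \<le> 4 powr y" using assms by (intro powr_mono) auto
  finally show ?thesis .
qed

section \<open>Valuations of factorials and Mertens' first theorem\<close>

lemma card_multiples:
  assumes "d > (0::nat)"
  shows "card {k \<in> {1..n}. d dvd k} = n div d"
proof -
  have "{k \<in> {1..n}. d dvd k} = (\<lambda>i. d * i) ` {1..n div d}"
    using assms by (auto simp: less_eq_div_iff_mult_less_eq mult.commute Suc_le_eq elim!: dvdE)
  moreover have "inj_on (\<lambda>i. d * i) {1..n div d}" using assms by (auto simp: inj_on_def)
  ultimately show ?thesis by (simp add: card_image)
qed

text \<open>Legendre's formula: the pairs of \<open>j\<close> and \<open>k\<close> with
  \<open>p ^ j\<close> dividing \<open>k\<close> are counted in two ways.\<close>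

lemma multiplicity_fact:
  assumes p: "prime (p::nat)"
  shows "multiplicity p (fact n) = (\<Sum>j = 1..n. n div p ^ j)"
proof -
  have "multiplicity p (fact n) = (\<Sum>k = 1..n. multiplicity p k)"
    unfolding fact_prod using p by (simp add: prime_elem_multiplicity_prod_distrib image_iff)
  also have "\<dots> = (\<Sum>k = 1..n. \<Sum>j = 1..n. if p ^ j dvd k then 1 else 0)"
  proof (rule sum.cong[OF refl])
    fix k assume k: "k \<in> {1..n}"
    have dvd: "p ^ j dvd k \<longleftrightarrow> j \<le> multiplicity p k" for j
      using k p by (intro power_dvd_iff_le_multiplicity) auto
    \<comment> \<open>The exponents occurring in \<open>k\<close> stay below \<open>k\<close>, so
      cutting them off at \<open>n\<close> loses nothing.\<close>
    have "multiplicity p k < 2 ^ multiplicity p k" by (rule less_exp)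
    also have "\<dots> \<le> p ^ multiplicity p k" using prime_ge_2_nat[OF p] by (intro power_mono) auto
    also have "\<dots> \<le> k" using k by (intro dvd_imp_le multiplicity_dvd) auto
    finally have "multiplicity p k < k" .
    then have "{j \<in> {1..n}. p ^ j dvd k} = {1..multiplicity p k}" using k unfolding dvd by auto
    then show "multiplicity p k = (\<Sum>j = 1..n. if p ^ j dvd k then 1 else 0)"
      by (simp add: sum.inter_filter[symmetric])
  qed
  also have "\<dots> = (\<Sum>j = 1..n. \<Sum>k = 1..n. if p ^ j dvd k then 1 else 0)" by (rule sum.swap)
  also have "\<dots> = (\<Sum>j = 1..n. n div p ^ j)"
  proof (rule sum.cong[OF refl])
    fix j
    have "(\<Sum>k = 1..n. if p ^ j dvd k then 1 else 0) = card {k \<in> {1..n}. p ^ j dvd k}"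
      by (simp add: sum.inter_filter[symmetric])
    then show "(\<Sum>k = 1..n. if p ^ j dvd k then 1 else 0) = n div p ^ j"
      using card_multiples[of "p ^ j" n] p by (simp add: prime_gt_0_nat)
  qed
  finally show ?thesis .
qed

text \<open>Dropping the rounding in Legendre's formula leaves a geometric series.\<close>

lemma multiplicity_fact_le:
  assumes p: "prime p"
  shows "real (multiplicity p (fact n)) \<le> real n / (real p - 1)"
proof -
  have p1: "real p > 1" using prime_gt_1_nat[OF p] by simp
  have "(\<Sum>j = 1..m. (1 / real p) ^ j) \<le> 1 / (real p - 1)" for m
  proof -
    have "(real p - 1) * (\<Sum>j = 1..m. (1 / real p) ^ j) = 1 - (1 / real p) ^ m"
    proof (induction m)
      case (Suc m)
      have "(real p - 1) * (1 / real p) ^ Suc m = (1 / real p) ^ m - (1 / real p) ^ Suc m"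
        using p1 by (simp add: field_simps)
      then show ?case using Suc by (simp add: distrib_left)
    qed simp
    then have "(\<Sum>j = 1..m. (1 / real p) ^ j) = (1 - (1 / real p) ^ m) / (real p - 1)"
      using p1 by (simp add: nonzero_eq_divide_eq mult.commute)
    also have "\<dots> \<le> 1 / (real p - 1)" using p1 by (intro divide_right_mono) auto
    finally show ?thesis .
  qed
  note geo = this
  have "real (multiplicity p (fact n)) = (\<Sum>j = 1..n. real (n div p ^ j))"
    by (simp add: multiplicity_fact[OF p])
  also have "\<dots> \<le> (\<Sum>j = 1..n. real n * (1 / real p) ^ j)"
  proof (rule sum_mono)
    fix j
    have "real (n div p ^ j) * real (p ^ j) \<le> real n"
      by (metis div_times_less_eq_dividend of_nat_le_iff of_nat_mult)
    then show "real (n div p ^ j) \<le> real n * (1 / real p) ^ j"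
      using p1 by (simp add: field_simps)
  qed
  also have "\<dots> = real n * (\<Sum>j = 1..n. (1 / real p) ^ j)" by (simp add: sum_distrib_left)
  also have "\<dots> \<le> real n * (1 / (real p - 1))" by (intro mult_left_mono geo) auto
  finally show ?thesis by simp
qed

lemma multiplicity_fact_ge:
  assumes p: "prime p"
  shows "real (multiplicity p (fact n)) \<ge> real n / real p - 1"
proof -
  have "n div p \<le> (\<Sum>j = 1..n. n div p ^ j)"
  proof (cases "n = 0")
    case False
    then show ?thesis using member_le_sum[of 1 "{1..n}" "\<lambda>j. n div p ^ j"] by simp
  qed simp
  then have "real (n div p) \<le> real (multiplicity p (fact n))"
    unfolding multiplicity_fact[OF p] by (simp only: of_nat_le_iff)
  moreover have "real n / real p - 1 \<le> real (n div p)"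
  proof -
    have "p > 0" using p by (rule prime_gt_0_nat)
    then have "n \<le> p * (n div p) + p" using dividend_less_times_div[of p n] by linarith
    then have "real n \<le> real p * (real (n div p) + 1)"
      by (metis distrib_left mult.right_neutral of_nat_1 of_nat_add of_nat_le_iff of_nat_mult)
    then show ?thesis using \<open>p > 0\<close> by (simp add: field_simps)
  qed
  ultimately show ?thesis by linarith
qed

lemma ln_fact_eq_sum_primes:
  "ln (fact n :: real) = (\<Sum>p | prime p \<and> real p \<le> real n. real (multiplicity p (fact n)) * ln (real p))"
proof -
  have pf: "prime_factors (fact n :: nat) = {p. prime p \<and> real p \<le> real n}"
    by (auto simp: in_prime_factors_iff prime_dvd_fact_iff)
  have "(fact n :: nat) = (\<Prod>p\<in>prime_factors (fact n). p ^ multiplicity p (fact n))"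
    by (rule prime_factorization_nat) simp
  then have "real (fact n) = real (\<Prod>p\<in>prime_factors (fact n). p ^ multiplicity p (fact n))"
    by (rule arg_cong)
  then have "(fact n :: real) = (\<Prod>p\<in>prime_factors (fact n :: nat). real p ^ multiplicity p (fact n :: nat))"
    by (simp only: of_nat_fact of_nat_prod of_nat_power)
  then have "ln (fact n :: real) = (\<Sum>p\<in>prime_factors (fact n :: nat). ln (real p ^ multiplicity p (fact n :: nat)))"
    by (simp only:) (rule ln_prod, auto dest: in_prime_factors_imp_prime prime_gt_0_nat)
  then show ?thesis unfolding pf
    by (simp add: ln_realpow prime_gt_0_nat)
qed

text \<open>The upper bound is \<open>n! \<le> n ^ n\<close>; the lower one holds because
  \<open>n ^ n / n!\<close> is a single term of the series of \<open>exp n\<close>.\<close>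

lemma ln_fact_bounds:
  assumes "n > 0"
  shows "ln (fact n :: real) \<le> n * ln n" "n * ln n - n \<le> ln (fact n :: real)"
proof -
  have "(fact n :: real) \<le> real n ^ n" by (metis fact_le_power of_nat_fact of_nat_le_iff of_nat_power le_refl)
  then have "ln (fact n :: real) \<le> ln (real n ^ n)" by (subst ln_le_cancel_iff) (use assms in auto)
  then show "ln (fact n :: real) \<le> n * ln n" using assms by (simp add: ln_realpow)
  have "real n ^ n / fact n \<le> exp (real n)"
  proof -
    have "(\<Sum>k\<in>{n}. real n ^ k /\<^sub>R fact k) \<le> (\<Sum>k. real n ^ k /\<^sub>R fact k)"
      by (intro sum_le_suminf summable_exp_generic) auto
    then show ?thesis by (simp add: exp_def field_simps)
  qed
  then have "ln (real n ^ n / fact n) \<le> ln (exp (real n))"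
    by (subst ln_le_cancel_iff) (use assms in auto)
  then show "n * ln n - n \<le> ln (fact n :: real)" using assms by (simp add: ln_div ln_realpow)
qed

text \<open>This controls the contribution of higher prime powers to the factorial. The right side
  is chosen to vanish at \<open>N = 1\<close> and to grow by at least the next term at each
  step.\<close>

lemma sum_ln_div_le:
  "N \<ge> 1 \<Longrightarrow> (\<Sum>k = 2..N. ln (real k) / (real k * (real k - 1))) \<le> 2 - (ln (real N) + 2) / real N"
proof (induction N rule: nat_induct_at_least)
  case (Suc N)
  have "real (Suc N) * (ln (real (Suc N)) - ln (real N)) \<le> 2"
  proof -
    have "ln (real (Suc N)) - ln (real N) = ln (1 + 1 / real N)"
    proof -
      have "1 + 1 / real N = real (Suc N) / real N" using Suc.hyps by (simp add: field_simps)
      then show ?thesis using Suc.hyps by (simp add: ln_div)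
    qed
    also have "\<dots> \<le> 1 / real N" by (rule ln_add_one_self_le_self) simp
    finally have "real (Suc N) * (ln (real (Suc N)) - ln (real N)) \<le> real (Suc N) * (1 / real N)"
      by (intro mult_left_mono) auto
    also have "\<dots> \<le> 2" using Suc.hyps by (simp add: field_simps)
    finally show ?thesis .
  qed
  then have "ln (real (Suc N)) \<le> real (Suc N) * (ln (real N) + 2) - real N * (ln (real (Suc N)) + 2)"
    by (simp add: algebra_simps)
  then have "ln (real (Suc N)) / (real (Suc N) * real N)
     \<le> (real (Suc N) * (ln (real N) + 2) - real N * (ln (real (Suc N)) + 2)) / (real (Suc N) * real N)"
    by (intro divide_right_mono) auto
  also have "\<dots> = (ln (real N) + 2) / real N - (ln (real (Suc N)) + 2) / real (Suc N)"
    using Suc.hyps by (simp add: diff_divide_distrib)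
  finally show ?case using Suc by (simp add: sum.cl_ivl_Suc)
qed simp

definition mertens_sum :: "real \<Rightarrow> real" where
  "mertens_sum t = (\<Sum>p | prime p \<and> real p \<le> t. ln (real p) / real p)"

text \<open>Both parts evaluate \<open>ln (fact n)\<close> over primes. The lower bound for
  valuations together with Chebyshev's bound gives the first. The upper bound
  \<open>n / (p - 1)\<close> exceeds \<open>n / p\<close> by \<open>n / (p * (p - 1))\<close>, which
  costs 2 in the second; the other 1 comes from the lower bound for the factorial.\<close>

lemma mertens_sum_nat:
  assumes n: "n > 0"
  shows "mertens_sum (real n) \<le> ln (real n) + ln 4" "mertens_sum (real n) \<ge> ln (real n) - 3"
proof -
  let ?A = "{p. prime p \<and> real p \<le> real n}"
  have fin: "finite ?A" by (rule finite_nat_le_real)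
  have p1: "real p > 1" if "p \<in> ?A" for p using that prime_gt_1_nat[of p] by simp
  have "real n * mertens_sum (real n) - (\<Sum>p\<in>?A. ln (real p)) = (\<Sum>p\<in>?A. (real n / real p - 1) * ln (real p))"
    unfolding mertens_sum_def by (simp add: sum_distrib_left sum_subtractf[symmetric] algebra_simps)
  also have "\<dots> \<le> (\<Sum>p\<in>?A. real (multiplicity p (fact n)) * ln (real p))"
    using p1 by (intro sum_mono mult_right_mono multiplicity_fact_ge) (auto simp: less_imp_le)
  also have "\<dots> \<le> n * ln n" unfolding ln_fact_eq_sum_primes[symmetric] by (rule ln_fact_bounds(1)[OF n])
  finally have "real n * mertens_sum (real n) \<le> n * ln n + n * ln 4"
    using sum_ln_primes_le[of "real n"] by simp
  then show "mertens_sum (real n) \<le> ln (real n) + ln 4"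
    using n by (simp flip: distrib_left)
  have "n * ln n - n \<le> (\<Sum>p\<in>?A. real (multiplicity p (fact n)) * ln (real p))"
    unfolding ln_fact_eq_sum_primes[symmetric] by (rule ln_fact_bounds(2)[OF n])
  also have "\<dots> \<le> (\<Sum>p\<in>?A. real n / (real p - 1) * ln (real p))"
    using p1 by (intro sum_mono mult_right_mono multiplicity_fact_le) (auto simp: less_imp_le)
  also have "\<dots> = (\<Sum>p\<in>?A. real n * (ln (real p) / real p + ln (real p) / (real p * (real p - 1))))"
  proof (rule sum.cong[OF refl])
    fix p assume "p \<in> ?A"
    then show "real n / (real p - 1) * ln (real p)
        = real n * (ln (real p) / real p + ln (real p) / (real p * (real p - 1)))"
      using p1[of p] by (simp add: field_simps)
  qed
  also have "\<dots> = real n * (mertens_sum (real n) + (\<Sum>p\<in>?A. ln (real p) / (real p * (real p - 1))))"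
    by (simp add: mertens_sum_def flip: sum_distrib_left sum.distrib)
  finally have "real n * (ln n - 1) \<le> real n * (mertens_sum (real n) + (\<Sum>p\<in>?A. ln (real p) / (real p * (real p - 1))))"
    by (simp add: algebra_simps)
  then have "ln n - 1 \<le> mertens_sum (real n) + (\<Sum>p\<in>?A. ln (real p) / (real p * (real p - 1)))"
    using n by simp
  moreover have "(\<Sum>p\<in>?A. ln (real p) / (real p * (real p - 1))) \<le> (\<Sum>k = 2..n. ln (real k) / (real k * (real k - 1)))"
    by (rule sum_mono2) (auto dest: prime_ge_2_nat)
  moreover have "\<dots> \<le> 2"
    using sum_ln_div_le[of n] n by (simp add: order_trans[OF sum_ln_div_le])
  ultimately show "mertens_sum (real n) \<ge> ln (real n) - 3" by linarith
qed

lemma mertens_sum_bounds: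
  assumes t: "t \<ge> 1"
  shows "mertens_sum t \<le> ln t + 2" "mertens_sum t \<ge> ln t - 4"
proof -
  define n where "n = nat \<lfloor>t\<rfloor>"
  have n: "n \<ge> 1" "real n \<le> t" "t \<le> 2 * real n" 
    using le_nat_floor_iff[of t 1] le_nat_floor_iff[of t n] t unfolding n_def by (simp, simp, linarith)
  have eq: "mertens_sum t = mertens_sum (real n)"
    unfolding mertens_sum_def n_def using le_nat_floor_iff[of t] t by (simp only: of_nat_le_iff)
  have ln4: "ln 4 \<le> (2::real)" using ln_4_le by simp
  have "ln (real n) \<le> ln t" using n by simp
  then show "mertens_sum t \<le> ln t + 2" using mertens_sum_nat(1)[of n] n eq ln4 by linarith
  have "ln t \<le> ln (2 * real n)" using n t by simp
  also have "\<dots> = ln 2 + ln (real n)" using n by (simp add: ln_mult)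
  finally have "ln t \<le> ln (real n) + 1" using ln_2_less_1 by linarith
  then show "mertens_sum t \<ge> ln t - 4" using mertens_sum_nat(2)[of n] n eq by linarith
qed

text \<open>The constant 6 adds the upper error 2 at one endpoint to the lower error 4 at the
  other.\<close>

lemma sum_ln_primes_div_between:
  assumes "1 \<le> a" "a \<le> b"
  shows "\<bar>(\<Sum>p | prime p \<and> a < real p \<and> real p \<le> b. ln (real p) / real p) - ln (b / a)\<bar> \<le> 6"
proof -
  have "{p. prime p \<and> real p \<le> b} = {p. prime p \<and> real p \<le> a} \<union> {p. prime p \<and> a < real p \<and> real p \<le> b}"
    using assms by auto
  then have "mertens_sum b = mertens_sum a + (\<Sum>p | prime p \<and> a < real p \<and> real p \<le> b. ln (real p) / real p)"
    unfolding mertens_sum_def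
    by (simp only:) (rule sum.union_disjoint, auto intro: finite_nat_le_real finite_subset[OF _ finite_nat_le_real[of prime b]])
  moreover have "ln (b / a) = ln b - ln a" using assms by (simp add: ln_div)
  ultimately show ?thesis using mertens_sum_bounds[of a] mertens_sum_bounds[of b] assms by (auto simp: abs_le_iff)
qed

section \<open>Averages of Kronecker symbols\<close>

definition rough_part :: "real \<Rightarrow> nat \<Rightarrow> nat multiset" where
  "rough_part y n = filter_mset (\<lambda>p. real p > y) (prime_factorization n)"

lemma rough_part_eq_empty_iff:
  assumes "n > 0"
  shows "rough_part y n = {#} \<longleftrightarrow> (\<forall>p. prime p \<longrightarrow> p dvd n \<longrightarrow> real p \<le> y)"
proof -
  have "rough_part y n = {#} \<longleftrightarrow> (\<forall>p\<in>#prime_factorization n. \<not> real p > y)"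
    unfolding rough_part_def set_mset_eq_empty_iff[symmetric] by auto
  then show ?thesis using assms by (auto simp: in_prime_factors_iff not_less)
qed

lemma prod_rough_part_le:
  assumes "n > 0"
  shows "\<Prod>\<^sub># (rough_part y n) \<le> n"
proof -
  have "\<Prod>\<^sub># (rough_part y n) dvd \<Prod>\<^sub># (prime_factorization n)"
    unfolding rough_part_def by (intro prod_mset_subset_imp_dvd) simp
  then show ?thesis using assms by (simp add: prod_mset_prime_factorization_nat dvd_imp_le)
qed

text \<open>Every prime up to \<open>y\<close> contributes the factor 1: an odd one because
  \<open>D\<close> is congruent to 1, and 2 because \<open>D\<close> is 1 modulo 8. As
  \<open>y \<ge> 2\<close>, all primes left in the rough part are odd, where the Kronecker symbol is
  a Legendre symbol.\<close>

lemma kronecker_eq_legendre_mset_rough_part: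
  assumes n: "n > 0" and y: "y \<ge> 2" and D8: "D mod 8 = 1"
    and D1: "\<And>p. prime p \<Longrightarrow> real p \<le> y \<Longrightarrow> [D = 1] (mod int p)"
  shows "kronecker D n = legendre_mset (rough_part y n) D"
proof -
  have "(\<Prod>p\<in>#N. kronecker_prime D p) = legendre_mset (filter_mset (\<lambda>p. real p > y) N) D"
    if "\<And>p. p \<in># N \<Longrightarrow> prime p" for N
    using that
  proof (induction N)
    case (add p N)
    have "kronecker_prime D p = (if real p > y then Legendre D (int p) else 1)"
    proof (cases "p = 2")
      case True
      moreover have "odd D" using D8 by presburger
      ultimately show ?thesis using D8 y by (simp add: kronecker_prime_def)
    next
      case False
      show ?thesis
      proof (cases "real p > y")
        case le: False
        then have "Legendre D (int p) = Legendre 1 (int p)" using add.prems by (intro Legendre_cong D1) auto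
        moreover have "int p > 1" using prime_gt_1_nat[of p] add.prems by simp
        ultimately show ?thesis using False le by (simp add: kronecker_prime_def Legendre_1)
      qed (use False in \<open>simp add: kronecker_prime_def\<close>)
    qed
    then show ?case using add by simp
  qed simp
  from this[of "prime_factorization n"] show ?thesis
    using n by (auto simp: kronecker_def rough_part_def)
qed

lemma prime_dvd_primorial: "prime p \<Longrightarrow> real p \<le> y \<Longrightarrow> p dvd primorial y"
  unfolding primorial_def by (rule dvd_prodI[where f = "\<lambda>p. p"]) (auto intro: finite_nat_le_real)

lemma prime_dvd_primorialD:
  assumes "prime p" "p dvd primorial y"
  shows "real p \<le> y"
proof -
  obtain r where "r \<in> {p. prime p \<and> real p \<le> y}" "p dvd r"
    using assms prime_dvd_prod_iff[OF finite_nat_le_real[of prime y] assms(1), of "\<lambda>p. p"]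
    by (auto simp: primorial_def)
  then show ?thesis using assms(1) primes_dvd_imp_eq by auto
qed

text \<open>The final hypothesis makes the average over \<open>F\<close> exceed the number of smooth integers
  minus \<open>1\<close>, so that integrality removes the error term.\<close>

lemma exists_large_kronecker_sum:
  fixes lo hi :: int
  assumes y: "y \<ge> 2" and lo: "0 < lo" and hi: "hi \<le> (int N)\<^sup>2"
    and F: "F = {D. lo \<le> D \<and> D \<le> hi \<and> [D = 1] (mod int (4 * primorial y)) \<and> squarefree D}"
    and card: "N * X\<^sup>2 < card F"
  shows "\<exists>D\<in>F. (\<Sum>n = 1..X. kronecker D n)
    \<ge> int (card {n. 1 \<le> n \<and> n \<le> X \<and> (\<forall>p. prime p \<longrightarrow> p dvd n \<longrightarrow> real p \<le> y)})"
proof (rule ccontr)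
  let ?P = "int (4 * primorial y)"
  let ?S = "{n. 1 \<le> n \<and> n \<le> X \<and> (\<forall>p. prime p \<longrightarrow> p dvd n \<longrightarrow> real p \<le> y)}"
  assume "\<not> ?thesis"
  then have small: "(\<Sum>n = 1..X. kronecker D n) \<le> int (card ?S) - 1" if "D \<in> F" for D
    using that by force
  have finF: "finite F" unfolding F by simp
  have cong: "[D = 1] (mod int p)" if "D \<in> F" "prime p" "real p \<le> y" for D p
  proof -
    have "[D = 1] (mod ?P)" using that by (simp add: F)
    moreover have "int p dvd ?P" using prime_dvd_primorial[OF that(2,3)]
      by (simp only: int_dvd_int_iff dvd_mult)
    ultimately show ?thesis by (rule cong_dvd_modulus)
  qed
  have mod8: "D mod 8 = 1" if "D \<in> F" for D
  proof -
    have "[D = 1] (mod ?P)" using that by (simp add: F)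
    \<comment> \<open>The explicit factor 4 and the prime 2 in the primorial combine to 8, which
      fixes the symbol at 2.\<close>
    moreover have "(8::int) dvd ?P"
    proof -
      have "2 dvd primorial y" using y by (intro prime_dvd_primorial) auto
      then have "4 * 2 dvd 4 * primorial y" by (intro mult_dvd_mono) auto
      then have "int (4 * 2) dvd ?P" by (simp only: int_dvd_int_iff)
      then show ?thesis by simp
    qed
    ultimately have "[D = 1] (mod 8)" by (rule cong_dvd_modulus)
    then show ?thesis by (simp add: cong_def)
  qed
  have kron: "kronecker D n = legendre_mset (rough_part y n) D" if "D \<in> F" "n \<ge> 1" for D n
    using that by (intro kronecker_eq_legendre_mset_rough_part y mod8 cong) auto
  \<comment> \<open>The error is \<open>N\<close> times the period of the symbol, and this period is
    the rough part of \<open>n\<close>, hence at most \<open>X\<close>.\<close>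
  have lower: "(\<Sum>D\<in>F. kronecker D n) \<ge> (if n \<in> ?S then int (card F) else 0) - int (N * X)"
    if n: "n \<in> {1..X}" for n
  proof -
    let ?M = "rough_part y n"
    have eq: "(\<Sum>D\<in>F. kronecker D n) = (\<Sum>D\<in>F. legendre_mset ?M D)"
      using n by (intro sum.cong refl kron) auto
    show ?thesis
    proof (cases "n \<in> ?S")
      case True
      then have "?M = {#}" by (subst rough_part_eq_empty_iff) auto
      then show ?thesis using True unfolding eq by simp
    next
      case False
      show ?thesis
      proof (cases "\<forall>p\<in>#?M. even (count ?M p)")
        case True
        then have "0 \<le> (\<Sum>D\<in>F. legendre_mset ?M D)" by (intro sum_nonneg legendre_mset_nonneg) auto
        moreover have "int (N * X) \<ge> 0" by simp
        ultimately show ?thesis unfolding eq if_not_P[OF False] by linarith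
      next
        case odd: False
        then obtain r where r: "odd (count ?M r)" by blast
        have "\<bar>\<Sum>D\<in>F. legendre_mset ?M D\<bar> \<le> int N * int (\<Prod>\<^sub># ?M)"
          unfolding F
        proof (rule squarefree_class_sum_bound[OF _ r _ lo hi])
          fix p assume "p \<in># ?M"
          then have p: "prime p" "real p > y" by (auto simp: rough_part_def)
          then have "\<not> p dvd primorial y" using prime_dvd_primorialD[of p y] by linarith
          moreover have "\<not> p dvd 4"
          proof
            assume "p dvd 4"
            then have "p dvd 2 ^ 2" by simp
            then have "p dvd 2" using p(1) prime_dvd_power by blast
            then show False using p y dvd_imp_le[of p 2] by auto
          qed
          ultimately have "\<not> p dvd 4 * primorial y" using p(1) by (simp add: prime_dvd_mult_iff)
          then have "coprime p (4 * primorial y)" using p(1) by (rule prime_imp_coprime[rotated])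
          then show "prime p \<and> 2 < p \<and> coprime (int p) ?P" using p y by (simp only: coprime_int_iff) auto
        qed (use primorial_pos in simp)
        also have "\<dots> \<le> int N * int X"
          using prod_rough_part_le[of n y] n by (intro mult_left_mono) auto
        also have "\<dots> = int (N * X)" by simp
        finally show ?thesis unfolding eq if_not_P[OF False] by linarith
      qed
    qed
  qed
  have S: "?S = {n \<in> {1..X}. n \<in> ?S}" by auto
  \<comment> \<open>The double sum is bounded below by adding up \<open>lower\<close> and above by
    adding up \<open>small\<close>. The comparison leaves \<open>card F \<le> N * X\<^sup>2\<close>,
    contrary to assumption.\<close>
  have "int (card F) * int (card ?S) - int (N * X\<^sup>2)
      = (\<Sum>n = 1..X. (if n \<in> ?S then int (card F) else 0) - int (N * X))"
  proof -
    have "(\<Sum>n = 1..X. if n \<in> ?S then int (card F) else 0) = (\<Sum>n\<in>?S. int (card F))"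
      by (subst (2) S, rule sum.inter_filter[symmetric]) simp
    then show ?thesis by (simp add: sum_subtractf power2_eq_square)
  qed
  also have "\<dots> \<le> (\<Sum>n = 1..X. \<Sum>D\<in>F. kronecker D n)" by (intro sum_mono lower)
  also have "\<dots> = (\<Sum>D\<in>F. \<Sum>n = 1..X. kronecker D n)" by (rule sum.swap)
  also have "\<dots> \<le> (\<Sum>D\<in>F. int (card ?S) - 1)" by (intro sum_mono small)
  also have "\<dots> = int (card F) * int (card ?S) - int (card F)" by (simp add: algebra_simps)
  finally have "int (card F) \<le> int (N * X\<^sup>2)" by linarith
  then have "card F \<le> N * X\<^sup>2" by (simp only: of_nat_le_iff)
  then show False using card by simp
qed

section \<open>The Dickman function\<close>

lemma dickman_le_1: "u \<in> {0..1} \<Longrightarrow> dickman u = 1"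
  using is_dickman_dickman by (auto simp: is_dickman_def)

lemma continuous_on_dickman: "S \<subseteq> {0..} \<Longrightarrow> continuous_on S dickman"
  using is_dickman_dickman continuous_on_subset by (auto simp: is_dickman_def)

lemma dickman_deriv: "u > 1 \<Longrightarrow> (dickman has_real_derivative - dickman (u - 1) / u) (at u)"
  using is_dickman_dickman by (auto simp: is_dickman_def)

lemma continuous_on_integral_dickman: "continuous_on {0..b} (\<lambda>t. integral {0..t} dickman)"
  by (intro indefinite_integral_continuous_1 integrable_continuous_real continuous_on_dickman) auto

lemma has_real_derivative_integral_dickman:
  assumes "t > 0"
  shows "((\<lambda>t. integral {0..t} dickman) has_real_derivative dickman t) (at t)"
proof -
  have "((\<lambda>t. integral {0..t} dickman) has_real_derivative dickman t) (at t within {0..t + 1})"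
    by (rule integral_has_real_derivative[OF continuous_on_dickman]) (use assms in auto)
  then show ?thesis using assms by (simp add: at_within_Icc_at)
qed

text \<open>This is the integrated delay equation: \<open>u * dickman u\<close> is the integral of
  \<open>dickman\<close> over the unit interval ending at \<open>u\<close>. Both sides equal 1 at
  \<open>u = 1\<close> and have equal derivatives beyond.\<close>

lemma dickman_delay_identity:
  assumes u: "u \<ge> 1"
  shows "u * dickman u = integral {0..u} dickman - integral {0..u - 1} dickman"
proof (cases "u = 1")
  case True
  have "integral {0..1} dickman = integral {0..1::real} (\<lambda>_. 1 :: real)"
    by (rule Henstock_Kurzweil_Integration.integral_cong) (rule dickman_le_1)
  then show ?thesis using True dickman_le_1[of 1] by simp
next
  case False
  define J where "J t = integral {0..t} dickman" for t
  have J_cont: "continuous_on {0..b} J" for b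
    unfolding J_def by (rule continuous_on_integral_dickman)
  have J_deriv: "(J has_real_derivative dickman t) (at t)" if "t > 0" for t
    using has_real_derivative_integral_dickman[OF that] by (simp add: J_def[abs_def])
  let ?h = "\<lambda>t. t * dickman t - J t + J (t - 1)"
  have "?h u = ?h 1"
  proof (rule DERIV_isconst2[of 1 u])
    show "continuous_on {1..u} ?h"
      by (intro continuous_intros continuous_on_dickman continuous_on_subset[OF J_cont[of u]]
          continuous_on_compose2[OF J_cont[of u]]) auto
    fix t assume t: "1 < t" "t < u"
    have "((\<lambda>t. J (t - 1)) has_real_derivative dickman (t - 1) * 1) (at t)"
      by (rule DERIV_chain2[OF J_deriv]) (use t in \<open>auto intro!: derivative_eq_intros\<close>)
    then have "(?h has_real_derivative
        (t * (- dickman (t - 1) / t) + 1 * dickman t) - dickman t + dickman (t - 1) * 1) (at t)"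
      by (intro DERIV_add DERIV_diff DERIV_mult' J_deriv dickman_deriv DERIV_ident)
         (use t in auto)
    then show "(?h has_real_derivative 0) (at t)" using t by simp
  qed (use u False in auto)
  moreover have "integral {0..1} dickman = integral {0..1::real} (\<lambda>_. 1 :: real)"
    by (rule Henstock_Kurzweil_Integration.integral_cong) (rule dickman_le_1)
  ultimately show ?thesis using dickman_le_1[of 1] by (simp add: J_def)
qed

text \<open>By continuity there would be a first point \<open>v\<close> with a nonpositive value,
  and \<open>v > 1\<close>. The delay identity writes \<open>v * dickman v\<close> as an integral of
  values that are positive before \<open>v\<close>, a contradiction.\<close>

lemma dickman_pos:
  assumes "u \<ge> 0"
  shows "dickman u > 0"
proof (rule ccontr)
  assume neg: "\<not> ?thesis"
  define Z where "Z = {t \<in> {0..u}. dickman t \<le> 0}"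
  have "closed Z"
    unfolding Z_def by (rule continuous_on_closed_Collect_le) (auto intro: continuous_on_dickman)
  moreover have "u \<in> Z" using assms neg by (simp add: Z_def)
  moreover have bdd: "bdd_below Z" unfolding Z_def by (rule bdd_belowI[of _ 0]) auto
  ultimately have "Inf Z \<in> Z" using closed_contains_Inf[of Z] by blast
  define v where "v = Inf Z"
  have v: "v \<ge> 0" "dickman v \<le> 0" "v \<le> u" using \<open>Inf Z \<in> Z\<close> by (auto simp: Z_def v_def)
  have before: "dickman t > 0" if "0 \<le> t" "t < v" for t
  proof (rule ccontr)
    assume "\<not> dickman t > 0"
    then have "t \<in> Z" using that v by (auto simp: Z_def)
    then show False using cInf_lower[OF _ bdd] that by (force simp: v_def)
  qed
  have v1: "v > 1" using v dickman_le_1[of v] by fastforce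
  define J where "J t = integral {0..t} dickman" for t
  have J_cont: "continuous_on {v - 1..v} J"
  proof -
    have "continuous_on {0..v} J"
      unfolding J_def by (rule continuous_on_integral_dickman)
    then show ?thesis by (rule continuous_on_subset) (use v1 in auto)
  qed
  have J_deriv: "(J has_real_derivative dickman t) (at t)" if "t > 0" for t
    using has_real_derivative_integral_dickman[OF that] by (simp add: J_def[abs_def])
  have "J (v - 1) < J v"
  proof (rule DERIV_pos_imp_increasing_open[of "v - 1" v])
    fix t assume t: "v - 1 < t" "t < v"
    have "dickman t > 0" by (rule before) (use t v1 in auto)
    moreover have "(J has_real_derivative dickman t) (at t)" by (rule J_deriv) (use t v1 in auto)
    ultimately show "\<exists>y. (J has_real_derivative y) (at t) \<and> y > 0" by blast
  qed (use J_cont in auto)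
  then have "v * dickman v > 0" using dickman_delay_identity[of v] v1 by (simp add: J_def)
  then show False using v v1 by (simp add: zero_less_mult_iff)
qed

lemma dickman_antimono:
  assumes "0 \<le> a" "a \<le> b"
  shows "dickman b \<le> dickman a"
proof -
  have *: "dickman b \<le> dickman a" if "1 \<le> a" "a \<le> b" for a b
  proof (rule DERIV_nonpos_imp_decreasing_open[OF that(2)])
    fix t assume t: "a < t" "t < b"
    have "(dickman has_real_derivative - dickman (t - 1) / t) (at t)"
      by (rule dickman_deriv) (use t that in auto)
    moreover have "- dickman (t - 1) / t \<le> 0"
      using dickman_pos[of "t - 1"] t that by (simp add: divide_nonneg_pos)
    ultimately show "\<exists>y. (dickman has_real_derivative y) (at t) \<and> y \<le> 0" by blast
  qed (use that in \<open>auto intro: continuous_on_dickman\<close>)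
  consider "b \<le> 1" | "a \<le> 1" "1 \<le> b" | "1 \<le> a" by linarith
  then show ?thesis
  proof cases
    case 2
    then show ?thesis using *[of 1 b] dickman_le_1[of 1] dickman_le_1[of a] assms by simp
  qed (use assms * in \<open>simp_all add: dickman_le_1\<close>)
qed

lemma dickman_bound: "u \<ge> 0 \<Longrightarrow> dickman u \<le> 1"
  using dickman_antimono[of 0 u] dickman_le_1[of 0] by simp

section \<open>Comparing sums over primes with the Dickman function\<close>

lemma dickman_slope_antimono:
  assumes "1 \<le> a" "a \<le> b"
  shows "dickman (b - 1) / b \<le> dickman (a - 1) / a"
  using assms dickman_antimono[of "a - 1" "b - 1"] dickman_pos[of "b - 1"]
  by (intro frac_le) auto

text \<open>By the mean value theorem the decrease per unit length is
  \<open>dickman (z - 1) / z\<close> at an interior point, and this quantity is antitone. The two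
  bounds match the endpoint estimates for a cell of primes.\<close>

lemma dickman_diff_bounds:
  assumes "1 \<le> a" "a \<le> b"
  shows "(b - a) * (dickman (b - 1) / b) \<le> dickman a - dickman b"
    and "dickman a - dickman b \<le> (b - a) * (dickman (a - 1) / a)"
proof -
  have "(b - a) * (dickman (b - 1) / b) \<le> dickman a - dickman b \<and>
    dickman a - dickman b \<le> (b - a) * (dickman (a - 1) / a)"
  proof (cases "a = b")
    case False
    then have "a < b" using assms by simp
    have "continuous_on {a..b} dickman" using assms by (auto intro: continuous_on_dickman)
    then obtain l z where z: "a < z" "z < b" "(dickman has_real_derivative l) (at z)"
      "dickman b - dickman a = (b - a) * l"
      using MVT[OF \<open>a < b\<close>] assms dickman_deriv
      by (metis dual_order.strict_trans2 real_differentiable_def)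
    have "l = - dickman (z - 1) / z"
      by (rule DERIV_unique[OF z(3) dickman_deriv]) (use z assms in auto)
    then have "dickman a - dickman b = (b - a) * (dickman (z - 1) / z)" using z(4) by simp
    moreover have "(b - a) * (dickman (b - 1) / b) \<le> (b - a) * (dickman (z - 1) / z)"
      using z assms by (intro mult_left_mono dickman_slope_antimono) auto
    moreover have "(b - a) * (dickman (z - 1) / z) \<le> (b - a) * (dickman (a - 1) / a)"
      using z assms by (intro mult_left_mono dickman_slope_antimono) auto
    ultimately show ?thesis by simp
  qed simp
  then show "(b - a) * (dickman (b - 1) / b) \<le> dickman a - dickman b"
    "dickman a - dickman b \<le> (b - a) * (dickman (a - 1) / a)" by auto
qed

text \<open>With \<open>L = ln x\<close>, the variable \<open>L / ln p\<close> runs through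
  \<open>[a, b]\<close> while \<open>p\<close> runs through the cell. Replacing it by an endpoint
  leaves the sum of \<open>ln p / p\<close>, which is \<open>L / a - L / b\<close> up to 6 by
  Mertens. The first term of the error is the cell length times the drop of the slope, the second
  comes from the 6.\<close>

lemma dickman_prime_cell:
  assumes ab: "1 \<le> a" "a \<le> b" and L: "L > 0"
  shows "\<bar>(\<Sum>p | prime p \<and> exp (L / b) < real p \<and> real p \<le> exp (L / a).
            dickman (L / ln (real p) - 1) / real p) - (dickman a - dickman b)\<bar>
    \<le> (b - a) * (dickman (a - 1) / a - dickman (b - 1) / b) + 6 * b / L"
proof -
  let ?A = "{p::nat. prime p \<and> exp (L / b) < real p \<and> real p \<le> exp (L / a)}"
  let ?s = "\<Sum>p\<in>?A. ln (real p) / real p"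
  have le: "exp (L / b) \<le> exp (L / a)" using ab L by (simp add: frac_le)
  have "\<bar>?s - ln (exp (L / a) / exp (L / b))\<bar> \<le> 6"
    by (rule sum_ln_primes_div_between) (use ab L le in auto)
  then have s: "\<bar>?s - (L / a - L / b)\<bar> \<le> 6" by (simp add: ln_div)
  have p: "real p > 0" "ln (real p) > 0" "a \<le> L / ln (real p)" "L / ln (real p) \<le> b" if "p \<in> ?A" for p
  proof -
    show pos: "real p > 0" using that by (auto simp: prime_gt_0_nat)
    have "ln (real p) > ln (exp (L / b))" using that pos by (subst ln_less_cancel_iff) auto
    then have lb: "ln (real p) > L / b" by simp
    moreover have "L / b > 0" using ab L by simp
    ultimately show lnp: "ln (real p) > 0" by linarith
    have "ln (real p) \<le> ln (exp (L / a))" using that pos by (subst ln_le_cancel_iff) auto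
    then have "ln (real p) \<le> L / a" by simp
    then show "a \<le> L / ln (real p)" using lnp ab by (simp add: field_simps)
    show "L / ln (real p) \<le> b" using lb lnp ab by (simp add: field_simps)
  qed
  \<comment> \<open>The Mertens weight is split off, leaving a factor that varies little over the
    cell.\<close>
  have eq: "dickman (L / ln (real p) - 1) / real p
      = (ln (real p) / real p) * (L / ln (real p) / L) * dickman (L / ln (real p) - 1)" if "p \<in> ?A" for p
    using p(1,2)[OF that] L by (simp add: field_simps)
  have upper: "(\<Sum>p\<in>?A. dickman (L / ln (real p) - 1) / real p) \<le> (b - a) * (dickman (a - 1) / a) + 6 * b / L"
  proof -
    have "(\<Sum>p\<in>?A. dickman (L / ln (real p) - 1) / real p) \<le> (\<Sum>p\<in>?A. (ln (real p) / real p) * (b / L) * dickman (a - 1))"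
    proof (rule sum_mono)
      fix p assume A: "p \<in> ?A"
      note p = p[OF A]
      show "dickman (L / ln (real p) - 1) / real p \<le> (ln (real p) / real p) * (b / L) * dickman (a - 1)"
        unfolding eq[OF A]
      proof (intro mult_mono dickman_antimono divide_right_mono)
        show "0 \<le> dickman (L / ln (real p) - 1)" using p ab by (intro less_imp_le[OF dickman_pos]) linarith
      qed (use p ab L in auto)
    qed
    also have "\<dots> = ?s * ((b / L) * dickman (a - 1))" by (simp only: sum_distrib_right mult.assoc)
    also have "\<dots> \<le> (L / a - L / b + 6) * ((b / L) * dickman (a - 1))"
      using s dickman_pos[of "a - 1"] ab L by (intro mult_right_mono mult_nonneg_nonneg) auto
    \<comment> \<open>The weight \<open>b / L\<close> turns the Mertens mass into
      \<open>(b - a) / a\<close>, so the slope at \<open>a\<close> appears as in the upper bound for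
      the difference of values.\<close>
    also have "\<dots> = (b - a) * (dickman (a - 1) / a) + 6 * b / L * dickman (a - 1)"
      using ab L by (simp add: field_simps)
    also have "\<dots> \<le> (b - a) * (dickman (a - 1) / a) + 6 * b / L * 1"
      using ab L by (intro add_left_mono mult_left_mono dickman_bound) auto
    finally show ?thesis by simp
  qed
  have lower: "(\<Sum>p\<in>?A. dickman (L / ln (real p) - 1) / real p) \<ge> (b - a) * (dickman (b - 1) / b) - 6 * b / L"
  proof -
    have "6 * a / L * dickman (b - 1) \<le> 6 * b / L * 1"
      using ab L dickman_pos[of "b - 1"]
      by (intro mult_mono dickman_bound divide_right_mono mult_left_mono) auto
    then have "(b - a) * (dickman (b - 1) / b) - 6 * b / L \<le> (b - a) * (dickman (b - 1) / b) - 6 * a / L * dickman (b - 1)"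
      by simp
    also have "\<dots> = (L / a - L / b - 6) * ((a / L) * dickman (b - 1))"
      using ab L by (simp add: field_simps)
    also have "\<dots> \<le> ?s * ((a / L) * dickman (b - 1))"
      using s dickman_pos[of "b - 1"] ab L by (intro mult_right_mono mult_nonneg_nonneg) auto
    also have "\<dots> = (\<Sum>p\<in>?A. (ln (real p) / real p) * (a / L) * dickman (b - 1))"
      by (simp only: sum_distrib_right mult.assoc)
    also have "\<dots> \<le> (\<Sum>p\<in>?A. dickman (L / ln (real p) - 1) / real p)"
    proof (rule sum_mono)
      fix p assume A: "p \<in> ?A"
      note p = p[OF A]
      have "1 \<le> L / ln (real p)" using p ab by linarith
      then have "ln (real p) \<le> L" using p by (simp add: le_divide_eq)
      then show "dickman (L / ln (real p) - 1) / real p \<ge> (ln (real p) / real p) * (a / L) * dickman (b - 1)"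
        unfolding eq[OF A]
      proof (intro mult_mono dickman_antimono divide_right_mono)
        show "0 \<le> dickman (b - 1)" using ab by (intro less_imp_le[OF dickman_pos]) linarith
      qed (use p ab L in auto)
    qed
    finally show ?thesis .
  qed
  show ?thesis
    using upper lower dickman_diff_bounds[OF ab] by (simp add: abs_le_iff algebra_simps)
qed

lemma split_interval_Collect:
  fixes a b c :: real
  assumes "a \<le> b" "b \<le> c"
  shows "{p. R p \<and> a < f p \<and> f p \<le> c} = {p. R p \<and> a < f p \<and> f p \<le> b} \<union> {p. R p \<and> b < f p \<and> f p \<le> c}"
  using assms by auto

text \<open>The range is cut into \<open>M\<close> cells of equal length in the variable
  \<open>ln x / ln p\<close>. Prime sums and differences of \<open>dickman\<close> telescope over
  the cells, and so do the slope drops, whose total is at most 1. This gives \<open>u / M\<close>;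
  the Mertens errors of the \<open>M\<close> cells add up to the other term.\<close>

lemma dickman_prime_sum:
  assumes y: "1 < y" "y < x" and M: "M > (0::nat)"
  defines "u \<equiv> ln x / ln y"
  shows "\<bar>(\<Sum>p | prime p \<and> y < real p \<and> real p \<le> x. dickman (ln x / ln (real p) - 1) / real p)
       - (1 - dickman u)\<bar> \<le> u / real M + 6 * real M * u / ln x"
proof -
  define L where "L = ln x"
  have L: "L > 0" and lny: "ln y > 0" using y by (auto simp: L_def)
  have u: "u > 1" using y by (simp add: u_def)
  \<comment> \<open>The partition runs downwards in \<open>p\<close>: the point 1 corresponds to
    \<open>p = x\<close> and the point \<open>u\<close> to \<open>p = y\<close>.\<close>
  define t where "t i = 1 + (u - 1) * real i / real M" for i :: nat
  have t0: "t 0 = 1" and tM: "t M = u" using M by (auto simp: t_def)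
  have mono: "t i \<le> t j" if "i \<le> j" for i j
    using that u by (simp add: t_def divide_right_mono mult_left_mono)
  have t1: "1 \<le> t i" for i using mono[of 0 i] t0 by simp
  have tu: "t i \<le> u" if "i \<le> M" for i using mono[OF that] tM by simp
  have step: "t (Suc i) - t i = (u - 1) / M" for i
  proof -
    have "t (Suc i) - t i = ((u - 1) * real (Suc i) - (u - 1) * real i) / M"
      by (simp add: t_def diff_divide_distrib)
    also have "(u - 1) * real (Suc i) - (u - 1) * real i = u - 1" by (simp add: algebra_simps)
    finally show ?thesis .
  qed
  define f where "f p = dickman (L / ln (real p) - 1) / real p" for p :: nat
  define W where "W z = (\<Sum>p | prime p \<and> z < real p \<and> real p \<le> x. f p)" for z
  have fin: "finite {p. prime p \<and> z < real p \<and> real p \<le> w}" for z w :: real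
    by (rule finite_subset[OF _ finite_nat_le_real[of prime w]]) auto
  have "W x = 0"
  proof -
    have "{p. prime p \<and> x < real p \<and> real p \<le> x} = {}" by auto
    then show ?thesis by (simp only: W_def sum.empty)
  qed
  have cell: "(\<Sum>p | prime p \<and> exp (L / t (Suc i)) < real p \<and> real p \<le> exp (L / t i). f p)
      = W (exp (L / t (Suc i))) - W (exp (L / t i))" for i
  proof -
    have le: "exp (L / t (Suc i)) \<le> exp (L / t i)"
      using L mono[of i "Suc i"] t1[of i] by (simp add: frac_le)
    have "exp (L / t i) \<le> exp (L / 1)" using L t1[of i] by (simp only: exp_le_cancel_iff) (intro divide_left_mono, auto)
    then have lex: "exp (L / t i) \<le> x" using y by (simp add: L_def)
    have "{p. prime p \<and> exp (L / t (Suc i)) < real p \<and> real p \<le> x}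
        = {p. prime p \<and> exp (L / t (Suc i)) < real p \<and> real p \<le> exp (L / t i)}
          \<union> {p. prime p \<and> exp (L / t i) < real p \<and> real p \<le> x}"
      by (rule split_interval_Collect[OF le lex])
    then have "W (exp (L / t (Suc i))) = (\<Sum>p | prime p \<and> exp (L / t (Suc i)) < real p \<and> real p \<le> exp (L / t i). f p) + W (exp (L / t i))"
      unfolding W_def by (simp only:) (rule sum.union_disjoint, auto intro: fin)
    then show ?thesis by simp
  qed
  have "W y = (\<Sum>i<M. W (exp (L / t (Suc i))) - W (exp (L / t i)))"
  proof -
    have "exp (L / t M) = y" "exp (L / t 0) = x" using y lny L by (auto simp: tM t0 u_def L_def)
    then show ?thesis using sum_lessThan_telescope[of "\<lambda>i. W (exp (L / t i))" M] \<open>W x = 0\<close> by simp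
  qed
  moreover have "1 - dickman u = (\<Sum>i<M. dickman (t i) - dickman (t (Suc i)))"
    using sum_lessThan_telescope'[of "\<lambda>i. dickman (t i)" M] by (simp add: t0 tM dickman_le_1)
  ultimately have "\<bar>W y - (1 - dickman u)\<bar>
      = \<bar>\<Sum>i<M. (W (exp (L / t (Suc i))) - W (exp (L / t i))) - (dickman (t i) - dickman (t (Suc i)))\<bar>"
    by (simp only: sum_subtractf)
  also have "\<dots> \<le> (\<Sum>i<M. \<bar>(W (exp (L / t (Suc i))) - W (exp (L / t i))) - (dickman (t i) - dickman (t (Suc i)))\<bar>)"
    by (rule sum_abs)
  also have "\<dots> \<le> (\<Sum>i<M. (u - 1) / M * (dickman (t i - 1) / t i - dickman (t (Suc i) - 1) / t (Suc i)) + 6 * u / L)"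
  proof (rule sum_mono)
    fix i assume "i \<in> {..<M}"
    then have "6 * t (Suc i) / L \<le> 6 * u / L" using tu[of "Suc i"] L by (intro divide_right_mono) auto
    moreover have "\<bar>(W (exp (L / t (Suc i))) - W (exp (L / t i))) - (dickman (t i) - dickman (t (Suc i)))\<bar>
      \<le> (t (Suc i) - t i) * (dickman (t i - 1) / t i - dickman (t (Suc i) - 1) / t (Suc i)) + 6 * t (Suc i) / L"
      unfolding cell[symmetric] f_def by (rule dickman_prime_cell[OF t1 mono L]) simp
    ultimately show "\<bar>(W (exp (L / t (Suc i))) - W (exp (L / t i))) - (dickman (t i) - dickman (t (Suc i)))\<bar>
      \<le> (u - 1) / M * (dickman (t i - 1) / t i - dickman (t (Suc i) - 1) / t (Suc i)) + 6 * u / L"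
      unfolding step by linarith
  qed
  also have "\<dots> = (u - 1) / M * (\<Sum>i<M. dickman (t i - 1) / t i - dickman (t (Suc i) - 1) / t (Suc i)) + M * (6 * u / L)"
    by (simp add: sum.distrib sum_distrib_left)
  also have "(\<Sum>i<M. dickman (t i - 1) / t i - dickman (t (Suc i) - 1) / t (Suc i)) = 1 - dickman (u - 1) / u"
    using sum_lessThan_telescope'[of "\<lambda>i. dickman (t i - 1) / t i" M] by (simp add: t0 tM dickman_le_1)
  also have "(u - 1) / M * (1 - dickman (u - 1) / u) \<le> (u - 1) / M * 1"
    using u dickman_pos[of "u - 1"] by (intro mult_left_mono) auto
  also have "(u - 1) / M * 1 \<le> u / M" by (simp add: divide_right_mono)
  finally show ?thesis by (simp add: W_def f_def L_def mult_ac)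
qed

section \<open>Counting smooth numbers\<close>

lemma card_le_real:
  assumes "x \<ge> 0"
  shows "card {n. 1 \<le> n \<and> real n \<le> x} = nat \<lfloor>x\<rfloor>"
proof -
  have "{n. 1 \<le> n \<and> real n \<le> x} = {1..nat \<lfloor>x\<rfloor>}"
    by (simp only: set_eq_iff mem_Collect_eq atLeastAtMost_iff le_nat_floor_iff[OF assms] simp_thms)
  then show ?thesis by simp
qed

lemma smooth_count_eq_floor:
  assumes "x \<ge> 0" "x \<le> y"
  shows "smooth_count x y = nat \<lfloor>x\<rfloor>"
proof -
  have "{n. 1 \<le> n \<and> real n \<le> x \<and> (\<forall>p. prime p \<longrightarrow> p dvd n \<longrightarrow> real p \<le> y)} = {n. 1 \<le> n \<and> real n \<le> x}"
  proof (intro Collect_cong iffI; elim conjE; intro conjI; (intro allI impI)?)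
    fix n p :: nat assume "1 \<le> n" "real n \<le> x" "prime p" "p dvd n"
    then have "real p \<le> real n" by (simp add: dvd_imp_le)
    then show "real p \<le> y" using \<open>real n \<le> x\<close> assms by linarith
  qed
  then show ?thesis using card_le_real[OF assms(1)] by (simp only: smooth_count_def)
qed

text \<open>The integers that are not \<open>y\<close>-smooth are sorted by their largest prime factor.\<close>

lemma buchstab:
  assumes x: "x \<ge> 0"
  shows "nat \<lfloor>x\<rfloor> = smooth_count x y
    + (\<Sum>p | prime p \<and> y < real p \<and> real p \<le> x. smooth_count (x / real p) (real p))"
proof -
  let ?A = "{p::nat. prime p \<and> y < real p \<and> real p \<le> x}"
  let ?S = "{n::nat. 1 \<le> n \<and> real n \<le> x \<and> (\<forall>p. prime p \<longrightarrow> p dvd n \<longrightarrow> real p \<le> y)}"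
  define B where "B p = {n::nat. 1 \<le> n \<and> real n \<le> x \<and> p dvd n \<and> (\<forall>r. prime r \<longrightarrow> r dvd n \<longrightarrow> r \<le> p)}" for p
  have finA: "finite ?A" by (rule finite_subset[OF _ finite_nat_le_real[of prime x]]) auto
  have finB: "finite (B p)" for p
    by (rule finite_subset[OF _ finite_nat_le_real[of "\<lambda>_. True" x]]) (auto simp: B_def)
  have finS: "finite ?S"
    by (rule finite_subset[OF _ finite_nat_le_real[of "\<lambda>_. True" x]]) auto
  have part: "{n. 1 \<le> n \<and> real n \<le> x} = ?S \<union> (\<Union>p\<in>?A. B p)"
  proof (intro equalityI subsetI)
    fix n assume n: "n \<in> {n. 1 \<le> n \<and> real n \<le> x}"
    show "n \<in> ?S \<union> (\<Union>p\<in>?A. B p)"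
    proof (cases "n \<in> ?S")
      case False
      then obtain r where r: "prime r" "r dvd n" "real r > y" using n by auto
      define p where "p = Max (prime_factors n)"
      have "r \<in> prime_factors n" using r n by (intro prime_factorsI) auto
      then have ne: "prime_factors n \<noteq> {}" by blast
      have "p \<in> prime_factors n" unfolding p_def using ne by (intro Max_in) auto
      then have p: "prime p" "p dvd n" by auto
      have max: "s \<le> p" if "prime s" "s dvd n" for s
        unfolding p_def using that n by (intro Max_ge) (auto simp: in_prime_factors_iff)
      have "real p \<le> real n" using p n by (simp add: dvd_imp_le)
      then have "p \<in> ?A" using p max[OF r(1,2)] r(3) n by auto
      moreover have "n \<in> B p" using n p max by (auto simp: B_def)
      ultimately show ?thesis by blast
    qed simp
  qed (auto simp: B_def)
  have disj: "?S \<inter> (\<Union>p\<in>?A. B p) = {}"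
  proof -
    have "n \<notin> ?S" if "p \<in> ?A" "n \<in> B p" for n p
      using that not_le by (auto simp: B_def)
    then show ?thesis by blast
  qed
  have card_UN: "card (\<Union>p\<in>?A. B p) = (\<Sum>p\<in>?A. card (B p))"
  proof (rule card_UN_disjoint[OF finA])
    show "\<forall>i\<in>?A. \<forall>j\<in>?A. i \<noteq> j \<longrightarrow> B i \<inter> B j = {}"
    proof (intro ballI impI equals0I)
      fix i j n assume "i \<in> ?A" "j \<in> ?A" "i \<noteq> j" "n \<in> B i \<inter> B j"
      then have "prime i" "prime j" "i dvd n" "j dvd n" by (simp_all add: B_def)
      then have "i \<le> j" "j \<le> i" using \<open>n \<in> B i \<inter> B j\<close> by (simp_all add: B_def)
      then show False using \<open>i \<noteq> j\<close> by simp
    qed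
  qed (use finB in auto)
  have card_B: "card (B p) = smooth_count (x / real p) (real p)" if "p \<in> ?A" for p
  proof -
    have p: "prime p" "p > 0" using that by (auto simp: prime_gt_0_nat)
    \<comment> \<open>Only one copy of \<open>p\<close> is removed; the cofactor may still contain
      \<open>p\<close>, which is why it is counted with smoothness bound \<open>p\<close>
      itself.\<close>
    have "B p = (\<lambda>m. p * m) ` {n. 1 \<le> n \<and> real n \<le> x / real p \<and> (\<forall>r. prime r \<longrightarrow> r dvd n \<longrightarrow> real r \<le> real p)}"
    proof (intro equalityI subsetI)
      fix n assume n: "n \<in> B p"
      then obtain m where m: "n = p * m" by (auto simp: B_def elim: dvdE)
      have "m \<in> {n. 1 \<le> n \<and> real n \<le> x / real p \<and> (\<forall>r. prime r \<longrightarrow> r dvd n \<longrightarrow> real r \<le> real p)}"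
        using n p unfolding m by (auto simp: B_def field_simps)
      then show "n \<in> (\<lambda>m. p * m) ` {n. 1 \<le> n \<and> real n \<le> x / real p \<and> (\<forall>r. prime r \<longrightarrow> r dvd n \<longrightarrow> real r \<le> real p)}"
        unfolding m by (rule imageI)
    next
      fix n assume "n \<in> (\<lambda>m. p * m) ` {n. 1 \<le> n \<and> real n \<le> x / real p \<and> (\<forall>r. prime r \<longrightarrow> r dvd n \<longrightarrow> real r \<le> real p)}"
      then obtain m where m: "n = p * m" "1 \<le> m" "real m \<le> x / real p"
        "\<And>r. prime r \<Longrightarrow> r dvd m \<Longrightarrow> r \<le> p" by auto
      have "r \<le> p" if "prime r" "r dvd n" for r
      proof (cases "r dvd m")
        case False
        then have "r dvd p" using that m(1) by (simp add: prime_dvd_mult_iff)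
        then show ?thesis using p by (simp add: dvd_imp_le)
      qed (use m that in auto)
      moreover have "real n \<le> x" using m p by (simp add: field_simps)
      ultimately show "n \<in> B p" using m p by (auto simp: B_def)
    qed
    moreover have "inj_on (\<lambda>m. p * m) U" for U using p by (auto simp: inj_on_def)
    ultimately show ?thesis unfolding smooth_count_def by (simp only: card_image)
  qed
  have "nat \<lfloor>x\<rfloor> = card (?S \<union> (\<Union>p\<in>?A. B p))"
    unfolding card_le_real[OF x, symmetric] part ..
  also have "\<dots> = card ?S + card (\<Union>p\<in>?A. B p)"
    using finA finB by (intro card_Un_disjoint finS finite_UN_I disj) auto
  also have "card (\<Union>p\<in>?A. B p) = (\<Sum>p\<in>?A. smooth_count (x / real p) (real p))"
    unfolding card_UN by (rule sum.cong[OF refl card_B])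
  finally show ?thesis by (simp only: smooth_count_def[of x y])
qed

text \<open>Both bounds use \<open>ln p \<ge> ln y\<close>, once with Mertens' and once with
  Chebyshev's estimate. The first loses against the true order of magnitude, but stays bounded when
  \<open>x\<close> is at most a fixed power of \<open>y\<close>.\<close>

lemma prime_sums_between:
  assumes y: "1 < y" "y \<le> x"
  shows "(\<Sum>p | prime p \<and> y < real p \<and> real p \<le> x. 1 / real p) \<le> (ln (x / y) + 6) / ln y"
    and "real (card {p. prime p \<and> y < real p \<and> real p \<le> x}) \<le> 2 * x / ln y"
proof -
  let ?A = "{p::nat. prime p \<and> y < real p \<and> real p \<le> x}"
  have lny: "ln y > 0" using y by simp
  have ln_p: "ln y \<le> ln (real p)" if "p \<in> ?A" for p using that y by auto
  have "ln y * (\<Sum>p\<in>?A. 1 / real p) \<le> (\<Sum>p\<in>?A. ln (real p) / real p)"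
    unfolding sum_distrib_left by (rule sum_mono) (use ln_p in \<open>auto intro!: divide_right_mono\<close>)
  also have "\<dots> \<le> ln (x / y) + 6"
    using sum_ln_primes_div_between[of y x] y by (simp add: abs_le_iff)
  finally show "(\<Sum>p\<in>?A. 1 / real p) \<le> (ln (x / y) + 6) / ln y"
    using lny by (simp add: le_divide_eq mult.commute)
  have ln4: "ln 4 \<le> (2::real)" using ln_4_le by simp
  have "ln y * real (card ?A) = (\<Sum>p\<in>?A. ln y)" by simp
  also have "\<dots> \<le> (\<Sum>p\<in>?A. ln (real p))" by (intro sum_mono ln_p)
  also have "\<dots> \<le> (\<Sum>p | prime p \<and> real p \<le> x. ln (real p))"
    by (rule sum_mono2[OF finite_nat_le_real]) (auto dest: prime_ge_1_nat)
  also have "\<dots> \<le> x * ln 4" using y by (intro sum_ln_primes_le) auto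
  also have "\<dots> \<le> x * 2" using y ln4 by (intro mult_left_mono) auto
  finally show "real (card ?A) \<le> 2 * x / ln y"
    using lny by (simp add: le_divide_eq mult.commute)
qed

text \<open>Buchstab's identity for the count is compared with its approximate analogue for
  \<open>dickman\<close>, given by the sum over primes. The relative errors
  \<open>\<epsilon>\<close> are weighted by the sum of \<open>1 / p\<close>, the additive errors 1
  by the number of primes, and the initial 1 pays for rounding \<open>x\<close>.\<close>

lemma smooth_count_buchstab_step:
  assumes y: "1 < y" "y < x" and \<epsilon>: "\<epsilon> \<ge> 0" and M: "M > (0::nat)"
    and approx: "\<And>p. prime p \<Longrightarrow> y < real p \<Longrightarrow> real p \<le> x \<Longrightarrow>
      \<bar>real (smooth_count (x / real p) (real p)) - x / real p * dickman (ln (x / real p) / ln (real p))\<bar>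
        \<le> \<epsilon> * (x / real p) + 1"
  defines "u \<equiv> ln x / ln y"
  shows "\<bar>real (smooth_count x y) - x * dickman u\<bar>
    \<le> 1 + x * (\<epsilon> * ((ln (x / y) + 6) / ln y) + 2 / ln y + u / real M + 6 * real M * u / ln x)"
proof -
  let ?A = "{p::nat. prime p \<and> y < real p \<and> real p \<le> x}"
  let ?\<Psi> = "\<lambda>p::nat. real (smooth_count (x / real p) (real p))"
  let ?\<rho> = "\<lambda>p::nat. dickman (ln x / ln (real p) - 1) / real p"
  have "\<bar>(\<Sum>p\<in>?A. ?\<Psi> p) - x * (\<Sum>p\<in>?A. ?\<rho> p)\<bar> = \<bar>\<Sum>p\<in>?A. ?\<Psi> p - x * ?\<rho> p\<bar>"
    by (simp only: sum_subtractf sum_distrib_left)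
  also have "\<dots> \<le> (\<Sum>p\<in>?A. \<bar>?\<Psi> p - x * ?\<rho> p\<bar>)" by (rule sum_abs)
  also have "\<dots> \<le> (\<Sum>p\<in>?A. \<epsilon> * x * (1 / real p) + 1)"
  proof (rule sum_mono)
    fix p assume p: "p \<in> ?A"
    then have "ln (real p) > 0" "real p > 0" using y by auto
    then have "ln (x / real p) / ln (real p) = ln x / ln (real p) - 1"
      using y by (simp add: ln_div diff_divide_distrib)
    then have eq: "x * ?\<rho> p = x / real p * dickman (ln (x / real p) / ln (real p))" by simp
    have "\<epsilon> * x * (1 / real p) = \<epsilon> * (x / real p)" by simp
    then show "\<bar>?\<Psi> p - x * ?\<rho> p\<bar> \<le> \<epsilon> * x * (1 / real p) + 1"
      unfolding eq using approx[of p] p by (simp only: mem_Collect_eq)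
  qed
  also have "\<dots> = \<epsilon> * x * (\<Sum>p\<in>?A. 1 / real p) + real (card ?A)"
    by (simp only: sum.distrib sum_distrib_left) simp
  also have "\<dots> \<le> \<epsilon> * x * ((ln (x / y) + 6) / ln y) + 2 * x / ln y"
    using prime_sums_between[of y x] y \<epsilon> by (intro add_mono mult_left_mono) auto
  finally have 1: "\<bar>(\<Sum>p\<in>?A. ?\<Psi> p) - x * (\<Sum>p\<in>?A. ?\<rho> p)\<bar>
    \<le> \<epsilon> * x * ((ln (x / y) + 6) / ln y) + 2 * x / ln y" .
  have "\<bar>x * (\<Sum>p\<in>?A. ?\<rho> p) - x * (1 - dickman u)\<bar> = x * \<bar>(\<Sum>p\<in>?A. ?\<rho> p) - (1 - dickman u)\<bar>"
    using y by (simp only: right_diff_distrib[symmetric] abs_mult)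
  also have "\<dots> \<le> x * (u / real M + 6 * real M * u / ln x)"
    unfolding u_def using y M by (intro mult_left_mono dickman_prime_sum) auto
  finally have 2: "\<bar>x * (\<Sum>p\<in>?A. ?\<rho> p) - x * (1 - dickman u)\<bar> \<le> x * (u / real M + 6 * real M * u / ln x)" .
  have "real (nat \<lfloor>x\<rfloor>) = real (smooth_count x y + (\<Sum>p\<in>?A. smooth_count (x / real p) (real p)))"
    by (rule arg_cong, rule buchstab) (use y in auto)
  then have 3: "real (nat \<lfloor>x\<rfloor>) = real (smooth_count x y) + (\<Sum>p\<in>?A. ?\<Psi> p)"
    by (simp only: of_nat_add of_nat_sum)
  have 4: "\<bar>real (nat \<lfloor>x\<rfloor>) - x\<bar> \<le> 1" using y by (simp add: abs_le_iff) linarith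
  have "\<bar>real (smooth_count x y) - x * dickman u\<bar>
    \<le> 1 + (\<epsilon> * x * ((ln (x / y) + 6) / ln y) + 2 * x / ln y) + x * (u / real M + 6 * real M * u / ln x)"
    using 1 2 3 4 unfolding abs_le_iff right_diff_distrib by linarith
  also have "\<dots> = 1 + x * (\<epsilon> * ((ln (x / y) + 6) / ln y) + 2 / ln y + u / real M + 6 * real M * u / ln x)"
    by (simp add: distrib_left mult_ac)
  finally show ?thesis .
qed

text \<open>The induction step is one application of Buchstab's identity: if
  \<open>x \<le> y ^ Suc N\<close> and \<open>p > y\<close>, then \<open>x / p \<le> p ^ N\<close>.
  The threshold has to be uniform in \<open>x\<close>, since the hypothesis is used at all pairs of
  \<open>x / p\<close> and \<open>p\<close> simultaneously.\<close>

lemma smooth_count_dickman: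
  assumes "N \<ge> (1::nat)" "\<epsilon> > 0"
  shows "\<exists>Y\<ge>2. \<forall>y\<ge>Y. \<forall>x\<ge>1. x \<le> y ^ N \<longrightarrow>
    \<bar>real (smooth_count x y) - x * dickman (ln x / ln y)\<bar> \<le> \<epsilon> * x + 1"
  using assms
proof (induction N arbitrary: \<epsilon> rule: nat_induct_at_least)
  case base
  show ?case
  proof (intro exI[of _ 2] conjI allI impI)
    fix y x :: real assume "2 \<le> y" "1 \<le> x" "x \<le> y ^ 1"
    then have "ln x / ln y \<in> {0..1}" by simp
    then have "dickman (ln x / ln y) = 1" by (rule dickman_le_1)
    moreover have "real (smooth_count x y) = of_int \<lfloor>x\<rfloor>"
      using smooth_count_eq_floor[of x y] \<open>1 \<le> x\<close> \<open>x \<le> y ^ 1\<close> by simp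
    ultimately have "real (smooth_count x y) - x * dickman (ln x / ln y) = of_int \<lfloor>x\<rfloor> - x" by simp
    moreover have "\<epsilon> * x > 0" using \<open>\<epsilon> > 0\<close> \<open>1 \<le> x\<close> by simp
    ultimately show "\<bar>real (smooth_count x y) - x * dickman (ln x / ln y)\<bar> \<le> \<epsilon> * x + 1" by linarith
  qed simp
next
  case (Suc N)
  \<comment> \<open>The weight multiplying the inductive error is at most \<open>N + 6\<close>. Each
    of the four error terms receives a budget of \<open>\<epsilon> / 4\<close>.\<close>
  define \<delta> where "\<delta> = \<epsilon> / (4 * (N + 6))"
  have \<delta>: "\<delta> > 0" using Suc.prems by (simp add: \<delta>_def)
  obtain Y0 where Y0: "Y0 \<ge> 2" "\<And>y x. y \<ge> Y0 \<Longrightarrow> x \<ge> 1 \<Longrightarrow> x \<le> y ^ N \<Longrightarrow>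
    \<bar>real (smooth_count x y) - x * dickman (ln x / ln y)\<bar> \<le> \<delta> * x + 1"
    using Suc.IH[OF \<delta>] by blast
  obtain M :: nat where "real M > 4 * (N + 1) / \<epsilon>" using reals_Archimedean2 by blast
  moreover have "4 * (N + 1) / \<epsilon> > 0" using Suc.prems by simp
  ultimately have M: "M > 0" "4 * (N + 1) \<le> \<epsilon> * M" using Suc.prems
    by (auto simp: field_simps simp del: of_nat_Suc intro!: Nat.gr0I)
  \<comment> \<open>The entries of the maximum serve, in order, to absorb constants into
    \<open>ln y\<close>, to bound \<open>2 / ln y\<close>, and to bound the Mertens error once
    \<open>M\<close> is fixed.\<close>
  define K where "K = max 1 (max (8 / \<epsilon>) (24 * real M * (N + 1) / \<epsilon>))"
  show ?case
  proof (intro exI[of _ "max Y0 (exp K)"] conjI allI impI)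
    fix y x :: real assume yY: "max Y0 (exp K) \<le> y" and x: "1 \<le> x" "x \<le> y ^ Suc N"
    have y2: "y \<ge> 2" using yY Y0(1) by simp
    have "ln (exp K) \<le> ln y" using yY y2 by (subst ln_le_cancel_iff) auto
    then have K: "K \<le> ln y" by simp
    then have lny: "ln y \<ge> 1" "8 / \<epsilon> \<le> ln y" "24 * real M * (N + 1) / \<epsilon> \<le> ln y"
      unfolding K_def by linarith+
    show "\<bar>real (smooth_count x y) - x * dickman (ln x / ln y)\<bar> \<le> \<epsilon> * x + 1"
    proof (cases "x \<le> y")
      case True
      then have "ln x / ln y \<in> {0..1}" using x y2 by simp
      then have "dickman (ln x / ln y) = 1" by (rule dickman_le_1)
      moreover have "real (smooth_count x y) = of_int \<lfloor>x\<rfloor>"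
        using smooth_count_eq_floor[of x y] x True by simp
      ultimately have "real (smooth_count x y) - x * dickman (ln x / ln y) = of_int \<lfloor>x\<rfloor> - x" by simp
      moreover have "\<epsilon> * x > 0" using Suc.prems x by simp
      ultimately show ?thesis by linarith
    next
      case False
      then have xy: "y < x" by simp
      define u where "u = ln x / ln y"
      have lnx: "ln x \<le> (N + 1) * ln y"
      proof -
        have "ln x \<le> ln (y ^ Suc N)" using x y2 by (subst ln_le_cancel_iff) auto
        also have "\<dots> = (N + 1) * ln y" using y2 by (subst ln_realpow) auto
        finally show ?thesis .
      qed
      then have u: "u \<le> N + 1" using lny by (simp add: u_def field_simps)
      have lnxy: "ln y \<le> ln x" using xy y2 by simp
      have "\<bar>real (smooth_count x y) - x * dickman u\<bar>
        \<le> 1 + x * (\<delta> * ((ln (x / y) + 6) / ln y) + 2 / ln y + u / real M + 6 * real M * u / ln x)"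
        unfolding u_def
      proof (rule smooth_count_buchstab_step)
        fix p assume p: "prime p" "y < real p" "real p \<le> x"
        show "\<bar>real (smooth_count (x / real p) (real p)) - x / real p * dickman (ln (x / real p) / ln (real p))\<bar>
          \<le> \<delta> * (x / real p) + 1"
        proof (rule Y0(2))
          have "x \<le> real p ^ Suc N" using x p y2 by (intro order_trans[OF x(2) power_mono]) auto
          then show "x / real p \<le> real p ^ N" using p y2 by (simp add: field_simps)
        qed (use p yY y2 in auto)
      qed (use xy y2 \<delta> M in auto)
      moreover have "\<delta> * ((ln (x / y) + 6) / ln y) \<le> \<epsilon> / 4"
      proof -
        have "ln (x / y) + 6 \<le> (N + 6) * ln y" using lnx lny x y2 by (simp add: ln_div algebra_simps)
        then have "(ln (x / y) + 6) / ln y \<le> N + 6" using lny by (simp add: divide_le_eq)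
        then have "\<delta> * ((ln (x / y) + 6) / ln y) \<le> \<delta> * (N + 6)" using \<delta> by (intro mult_left_mono) auto
        also have "\<dots> = \<epsilon> / 4" by (simp add: \<delta>_def field_simps)
        finally show ?thesis .
      qed
      moreover have "2 / ln y \<le> \<epsilon> / 4" using lny(1,2) Suc.prems by (simp add: field_simps)
      moreover have "u / real M \<le> \<epsilon> / 4"
      proof -
        have "u / real M \<le> (N + 1) / M" using u by (intro divide_right_mono) auto
        also have "\<dots> \<le> \<epsilon> / 4" using M by (simp add: field_simps)
        finally show ?thesis .
      qed
      moreover have "6 * real M * u / ln x \<le> \<epsilon> / 4"
      proof -
        have "6 * real M * u / ln x \<le> 6 * real M * (N + 1) / ln y"
          using u lny lnxy by (intro frac_le mult_left_mono) (auto simp: u_def)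
        also have "\<dots> \<le> \<epsilon> / 4" using lny(1,3) Suc.prems by (simp add: field_simps)
        finally show ?thesis .
      qed
      ultimately have "\<bar>real (smooth_count x y) - x * dickman u\<bar> \<le> 1 + x * (\<epsilon> / 4 + \<epsilon> / 4 + \<epsilon> / 4 + \<epsilon> / 4)"
        using x by (elim order_trans) (intro add_left_mono mult_left_mono add_mono, auto)
      then show ?thesis by (simp add: u_def mult.commute)
    qed
  qed (use Y0 in auto)
qed

section \<open>Large character sums\<close>

text \<open>For \<open>x = y powr B\<close> the argument of \<open>dickman\<close> is exactly
  \<open>B\<close>, and the additive error 1 disappears after division by \<open>x\<close> since
  \<open>x\<close> tends to infinity. This fails for \<open>B = 0\<close>, where the count is simply
  1.\<close>

lemma smooth_count_powr_tendsto:
  assumes B: "B \<ge> 0"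
  shows "((\<lambda>y. real (smooth_count (y powr B) y) / y powr B) \<longlongrightarrow> dickman B) at_top"
proof (cases "B = 0")
  case True
  have "\<forall>\<^sub>F y in at_top. dickman B = real (smooth_count (y powr B) y) / y powr B"
    using eventually_ge_at_top[of "1::real"]
  proof eventually_elim
    case (elim y)
    then show ?case using True smooth_count_eq_floor[of 1 y] by (simp add: dickman_le_1)
  qed
  then show ?thesis by (rule Lim_transform_eventually[OF tendsto_const])
next
  case False
  then have B: "B > 0" using assms by simp
  show ?thesis
  proof (rule tendstoI)
    fix e :: real assume e: "e > 0"
    define N where "N = nat \<lceil>B\<rceil>"
    have N: "N \<ge> 1" "B \<le> real N" unfolding N_def using B by linarith+
    obtain Y where Y: "Y \<ge> 2" "\<And>y x. y \<ge> Y \<Longrightarrow> x \<ge> 1 \<Longrightarrow> x \<le> y ^ N \<Longrightarrow>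
        \<bar>real (smooth_count x y) - x * dickman (ln x / ln y)\<bar> \<le> e / 2 * x + 1"
      using smooth_count_dickman[OF N(1), of "e / 2"] e by auto
    have "filterlim (\<lambda>y::real. y powr B) at_top at_top" using B by real_asymp
    then have "\<forall>\<^sub>F y::real in at_top. y powr B > 2 / e" by (simp add: filterlim_at_top_dense)
    then show "\<forall>\<^sub>F y in at_top. dist (real (smooth_count (y powr B) y) / y powr B) (dickman B) < e"
      using eventually_ge_at_top[of Y]
    proof eventually_elim
      case (elim y)
      define x where "x = y powr B"
      have y: "y \<ge> 2" using elim Y(1) by simp
      have x1: "x \<ge> 1" using y B by (simp add: x_def ge_one_powr_ge_zero)
      have "x \<le> y powr N" unfolding x_def using y N by (intro powr_mono) auto
      then have "x \<le> y ^ N" using y by (simp add: powr_realpow)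
      moreover have "ln x / ln y = B" using y by (simp add: x_def ln_powr)
      ultimately have "\<bar>real (smooth_count x y) - x * dickman B\<bar> \<le> e / 2 * x + 1"
        using Y(2)[of y x] elim x1 by simp
      also have "\<dots> < e * x" using elim e by (simp add: x_def field_simps)
      finally have "\<bar>real (smooth_count x y) - x * dickman B\<bar> < e * x" .
      moreover have "real (smooth_count x y) / x - dickman B = (real (smooth_count x y) - x * dickman B) / x"
        using x1 by (simp add: field_simps)
      ultimately show ?case
        using x1 unfolding x_def[symmetric] by (simp add: dist_real_def abs_divide divide_less_eq)
    qed
  qed
qed

lemma class_mod_primorial_subset_discriminants:
  "{D. \<lceil>q\<rceil> \<le> D \<and> D \<le> \<lfloor>2 * q\<rfloor> \<and> [D = 1] (mod int (4 * primorial y)) \<and> squarefree D}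
    \<subseteq> discriminants_between q (2 * q)" if "q > 0"
proof
  fix D assume D: "D \<in> {D. \<lceil>q\<rceil> \<le> D \<and> D \<le> \<lfloor>2 * q\<rfloor> \<and> [D = 1] (mod int (4 * primorial y)) \<and> squarefree D}"
  then have "[D = 1] (mod int (4 * primorial y))" by simp
  then have "[D = 1] (mod 4)" by (rule cong_dvd_modulus) simp
  then have "D mod 4 = 1" by (simp add: cong_def)
  moreover have "q \<le> real_of_int D" "real_of_int D \<le> 2 * q" using D by (auto simp: ceiling_le_iff le_floor_iff)
  ultimately show "D \<in> discriminants_between q (2 * q)"
    using D that by (simp add: discriminants_between_def fundamental_discriminant_def)
qed

text \<open>The bound \<open>4\<^sup>y\<close> on the primorial at \<open>y = (ln q) / 3\<close> is \<open>q\<close> to the power \<open>(ln 4) / 3 < 7 / 15\<close>.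
  That this exponent is below \<open>1 / 2\<close> lets the main term \<open>q / (8 * 4\<^sup>y)\<close> beat the sieve error,
  which is of order \<open>sqrt q\<close> up to the factor \<open>x\<^sup>2\<close>.\<close>

lemma eventually_large_kronecker_sum:
  "\<forall>\<^sub>F q :: real in at_top. \<forall>x. 1 \<le> x \<and> x \<le> exp (sqrt (ln q)) \<longrightarrow>
     (\<exists>D\<in>discriminants_between q (2 * q).
        (\<Sum>n = 1..nat \<lfloor>x\<rfloor>. kronecker D n) \<ge> int (smooth_count x (ln q / 3)))"
proof -
  \<comment> \<open>This inequality yields \<open>N * X\<^sup>2 < card ?F\<close>. The left side
    dominates \<open>N * X\<^sup>2 + 1 + N\<close>; on the right, \<open>q - 2\<close> allows for
    rounding both ends of the interval, and 8 is twice the factor 4 of the modulus.\<close>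
  have "\<forall>\<^sub>F q :: real in at_top. (sqrt (2 * q) + 1) * ((exp (sqrt (ln q)))\<^sup>2 + 1) + 1
      < (q - 2) / (8 * q powr (7 / 15))"
    by real_asymp
  then show ?thesis
    \<comment> \<open>From here on \<open>ln q / 3\<close> is at least 2, so the prime 2 occurs in
      the primorial.\<close>
    using eventually_ge_at_top[of "exp 6"]
  proof eventually_elim
    case (elim q)
    have "1 + 6 \<le> exp (6 :: real)" by (rule exp_ge_add_one_self)
    then have q: "q > 3" using elim(2) by linarith
    define y where "y = ln q / 3"
    have "ln (exp 6) \<le> ln q" using elim q by (subst ln_le_cancel_iff) auto
    then have y: "y \<ge> 2" by (simp add: y_def)
    show ?case
    proof (intro allI impI, elim conjE)
      fix x :: real assume x: "1 \<le> x" "x \<le> exp (sqrt (ln q))"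
      define X where "X = nat \<lfloor>x\<rfloor>"
      \<comment> \<open>The square of \<open>N\<close> reaches \<open>2 * q\<close>, so only squares
        of numbers up to \<open>N\<close> can divide a \<open>D\<close> in the range.\<close>
      define N where "N = nat \<lceil>sqrt (2 * q)\<rceil>"
      let ?P = "int (4 * primorial y)"
      let ?F = "{D. \<lceil>q\<rceil> \<le> D \<and> D \<le> \<lfloor>2 * q\<rfloor> \<and> [D = 1] (mod ?P) \<and> squarefree D}"
      have X: "real X \<le> exp (sqrt (ln q))" using x unfolding X_def by linarith
      have N: "sqrt (2 * q) \<le> real N" "real N \<le> sqrt (2 * q) + 1"
        using q unfolding N_def by (auto simp: of_nat_nat)
      have hi: "\<lfloor>2 * q\<rfloor> \<le> (int N)\<^sup>2"
      proof -
        have "2 * q = (sqrt (2 * q))\<^sup>2" using q by simp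
        also have "\<dots> \<le> (real N)\<^sup>2" using N(1) q by (intro power_mono) auto
        finally have "2 * q \<le> real_of_int ((int N)\<^sup>2)" by simp
        then show ?thesis by linarith
      qed
      have "real (primorial y) \<le> 4 powr y" using y by (intro primorial_le_powr) auto
      also have "\<dots> = exp (ln q / 3 * ln 4)" by (simp add: powr_def y_def mult.commute)
      also have "\<dots> \<le> exp (7 / 15 * ln q)"
      proof -
        have "ln q / 3 * ln 4 \<le> ln q / 3 * (7 / 5)" using q ln_4_le by (intro mult_left_mono) auto
        then show ?thesis by simp
      qed
      also have "\<dots> = q powr (7 / 15)" using q by (simp add: powr_def)
      finally have prim: "real (primorial y) \<le> q powr (7 / 15)" .
      have "real N * (real X)\<^sup>2 + 1 + real N \<le> (sqrt (2 * q) + 1) * ((exp (sqrt (ln q)))\<^sup>2 + 1) + 1"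
      proof -
        have "real N * ((real X)\<^sup>2 + 1) \<le> (sqrt (2 * q) + 1) * ((exp (sqrt (ln q)))\<^sup>2 + 1)"
          using N X q by (intro mult_mono add_mono power_mono) auto
        then show ?thesis by (simp add: algebra_simps)
      qed
      also have "\<dots> < (q - 2) / (8 * q powr (7 / 15))" by (rule elim(1))
      also have "\<dots> \<le> (q - 2) / (8 * real (primorial y))"
        using q prim primorial_pos[of y] by (intro divide_left_mono mult_left_mono mult_pos_pos) auto
      also have "\<dots> \<le> real_of_int (\<lfloor>2 * q\<rfloor> - \<lceil>q\<rceil>) / (8 * real (primorial y))"
      proof (rule divide_right_mono)
        show "q - 2 \<le> real_of_int (\<lfloor>2 * q\<rfloor> - \<lceil>q\<rceil>)" unfolding of_int_diff by linarith
      qed simp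
      also have "\<dots> = real_of_int (\<lfloor>2 * q\<rfloor> - \<lceil>q\<rceil>) / real_of_int (2 * ?P)" by simp
      also have "\<dots> \<le> real (card ?F) + 1 + real N"
      proof -
        have "\<lceil>q\<rceil> \<le> \<lfloor>2 * q\<rfloor>" using q by linarith
        then have "real (card ?F) \<ge> real_of_int (\<lfloor>2 * q\<rfloor> - \<lceil>q\<rceil>) / real_of_int (2 * ?P) - 1 - real N"
          using q hi primorial_pos[of y] by (intro card_squarefree_class) auto
        then show ?thesis by linarith
      qed
      finally have "real (N * X\<^sup>2) < real (card ?F)" by simp
      then have "N * X\<^sup>2 < card ?F" by (simp only: of_nat_less_iff)
      then obtain D where D: "D \<in> ?F" "(\<Sum>n = 1..X. kronecker D n)
          \<ge> int (card {n. 1 \<le> n \<and> n \<le> X \<and> (\<forall>p. prime p \<longrightarrow> p dvd n \<longrightarrow> real p \<le> y)})"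
        using exists_large_kronecker_sum[OF y _ hi refl, of "\<lceil>q\<rceil>" X] q by auto
      moreover have "{n. 1 \<le> n \<and> n \<le> X \<and> (\<forall>p. prime p \<longrightarrow> p dvd n \<longrightarrow> real p \<le> y)}
          = {n. 1 \<le> n \<and> real n \<le> x \<and> (\<forall>p. prime p \<longrightarrow> p dvd n \<longrightarrow> real p \<le> y)}"
        unfolding X_def using x by (subst le_nat_floor_iff) auto
      ultimately show "\<exists>D\<in>discriminants_between q (2 * q).
          (\<Sum>n = 1..nat \<lfloor>x\<rfloor>. kronecker D n) \<ge> int (smooth_count x (ln q / 3))"
        using class_mod_primorial_subset_discriminants[of q y] q
        unfolding smooth_count_def X_def[symmetric] y_def[symmetric] by auto
    qed
  qed
qed

text \<open>For negative \<open>B\<close> the sum is empty as soon as \<open>x < 1\<close>, so no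
  positive \<open>c\<close> could exist; hence the restriction on \<open>B\<close>. Both
  \<open>\<epsilon>\<close> and \<open>c\<close> may depend on \<open>B\<close> but \<open>c\<close>
  not on \<open>q\<close>.\<close>

theorem theorem9:
  "(\<forall>\<^sub>F q :: real in at_top. \<forall>x::real. 1 \<le> x \<and> x \<le> exp (sqrt (ln q)) \<longrightarrow>
      (MAX D\<in>discriminants_between q (2 * q). \<bar>\<Sum>n = 1..nat \<lfloor>x\<rfloor>. kronecker D n\<bar>)
        \<ge> int (smooth_count x (ln q / 3))) \<and>
   (\<forall>B::real. B \<ge> 0 \<longrightarrow>
      (\<exists>(\<epsilon> :: real \<Rightarrow> real) (c::real). (\<epsilon> \<longlongrightarrow> 0) at_top \<and> c > 0 \<and>
        (\<forall>\<^sub>F q :: real in at_top. let x = (ln q / 3) powr B in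
           (\<exists>D\<in>discriminants_between q (2 * q).
              real_of_int (\<Sum>n = 1..nat \<lfloor>x\<rfloor>. kronecker D n) \<ge> (dickman B + \<epsilon> q) * x) \<and>
           (dickman B + \<epsilon> q) * x \<ge> c * x)))"
proof (intro conjI allI impI)
  show "\<forall>\<^sub>F q :: real in at_top. \<forall>x::real. 1 \<le> x \<and> x \<le> exp (sqrt (ln q)) \<longrightarrow>
      (MAX D\<in>discriminants_between q (2 * q). \<bar>\<Sum>n = 1..nat \<lfloor>x\<rfloor>. kronecker D n\<bar>)
        \<ge> int (smooth_count x (ln q / 3))"
    using eventually_large_kronecker_sum
  proof eventually_elim
    case (elim q)
    show ?case
    proof (intro allI impI)
      fix x assume "1 \<le> x \<and> x \<le> exp (sqrt (ln q))"
      then obtain D where D: "D \<in> discriminants_between q (2 * q)"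
        "int (smooth_count x (ln q / 3)) \<le> (\<Sum>n = 1..nat \<lfloor>x\<rfloor>. kronecker D n)" using elim by blast
      note D(2)
      also have "(\<Sum>n = 1..nat \<lfloor>x\<rfloor>. kronecker D n) \<le> \<bar>\<Sum>n = 1..nat \<lfloor>x\<rfloor>. kronecker D n\<bar>" by simp
      also have "\<dots> \<le> (MAX D\<in>discriminants_between q (2 * q). \<bar>\<Sum>n = 1..nat \<lfloor>x\<rfloor>. kronecker D n\<bar>)"
        using D(1) by (intro Max_ge finite_imageI finite_discriminants_between imageI)
      finally show "int (smooth_count x (ln q / 3))
        \<le> (MAX D\<in>discriminants_between q (2 * q). \<bar>\<Sum>n = 1..nat \<lfloor>x\<rfloor>. kronecker D n\<bar>)" .
    qed
  qed
next
  fix B :: real assume B: "B \<ge> 0"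
  define r where "r y = real (smooth_count (y powr B) y) / y powr B" for y :: real
  \<comment> \<open>This records how far the normalised count \<open>r\<close> falls short of its
    limit, so that \<open>dickman B + \<epsilon> q\<close> never exceeds
    \<open>r (ln q / 3)\<close>.\<close>
  define \<epsilon> where "\<epsilon> q = min 0 (r (ln q / 3) - dickman B)" for q :: real
  have "filterlim (\<lambda>q::real. ln q / 3) at_top at_top" by real_asymp
  then have "((\<lambda>q. r (ln q / 3)) \<longlongrightarrow> dickman B) at_top"
    using filterlim_compose[OF smooth_count_powr_tendsto[OF B]] by (simp add: r_def)
  then have "((\<lambda>q. min 0 (r (ln q / 3) - dickman B)) \<longlongrightarrow> min 0 (dickman B - dickman B)) at_top"
    by (intro tendsto_min tendsto_diff tendsto_const)
  then have \<epsilon>: "(\<epsilon> \<longlongrightarrow> 0) at_top" by (simp add: \<epsilon>_def[abs_def])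
  have pos: "dickman B > 0" using B by (rule dickman_pos)
  \<comment> \<open>Positivity of \<open>dickman B\<close> makes half of it an admissible
    \<open>c\<close>.\<close>
  have "\<forall>\<^sub>F q in at_top. \<epsilon> q > - dickman B / 2" using order_tendstoD(1)[OF \<epsilon>, of "- dickman B / 2"] pos by simp
  moreover have "\<forall>\<^sub>F q :: real in at_top. (ln q / 3) powr B \<le> exp (sqrt (ln q))" by real_asymp
  \<comment> \<open>Then \<open>ln q / 3\<close> is at least 1, and with \<open>B \<ge> 0\<close> so
    is \<open>x\<close>.\<close>
  moreover have "\<forall>\<^sub>F q :: real in at_top. q \<ge> exp 3" by (rule eventually_ge_at_top)
  ultimately have "\<forall>\<^sub>F q :: real in at_top. let x = (ln q / 3) powr B in
      (\<exists>D\<in>discriminants_between q (2 * q).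
         real_of_int (\<Sum>n = 1..nat \<lfloor>x\<rfloor>. kronecker D n) \<ge> (dickman B + \<epsilon> q) * x) \<and>
      (dickman B + \<epsilon> q) * x \<ge> dickman B / 2 * x"
    using eventually_large_kronecker_sum
  proof eventually_elim
    case (elim q)
    define y where "y = ln q / 3"
    define x where "x = y powr B"
    have "q > 0" using elim(3) by (rule less_le_trans[OF exp_gt_zero])
    then have "3 \<le> ln q" using elim(3) by (simp add: ln_ge_iff)
    then have "x \<ge> 1" using B by (simp add: x_def y_def ge_one_powr_ge_zero)
    moreover have "x \<le> exp (sqrt (ln q))" using elim(2) by (simp add: x_def y_def)
    ultimately obtain D where D: "D \<in> discriminants_between q (2 * q)"
      "int (smooth_count x y) \<le> (\<Sum>n = 1..nat \<lfloor>x\<rfloor>. kronecker D n)" using elim(4) unfolding y_def by blast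
    have "(dickman B + \<epsilon> q) * x \<le> r y * x"
      using \<open>x \<ge> 1\<close> by (intro mult_right_mono) (auto simp: \<epsilon>_def y_def)
    also have "\<dots> = real (smooth_count x y)" using \<open>x \<ge> 1\<close> by (simp add: r_def x_def[symmetric])
    also have "\<dots> \<le> real_of_int (\<Sum>n = 1..nat \<lfloor>x\<rfloor>. kronecker D n)" using D(2) by linarith
    finally have "(dickman B + \<epsilon> q) * x \<le> real_of_int (\<Sum>n = 1..nat \<lfloor>x\<rfloor>. kronecker D n)" .
    moreover have "dickman B / 2 * x \<le> (dickman B + \<epsilon> q) * x"
      using elim(1) \<open>x \<ge> 1\<close> by (intro mult_right_mono) auto
    ultimately show ?case using D(1) unfolding Let_def y_def[symmetric] x_def[symmetric] by blast
  qed
  then show "\<exists>(\<epsilon> :: real \<Rightarrow> real) (c::real). (\<epsilon> \<longlongrightarrow> 0) at_top \<and> c > 0 \<and>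
        (\<forall>\<^sub>F q :: real in at_top. let x = (ln q / 3) powr B in
           (\<exists>D\<in>discriminants_between q (2 * q).
              real_of_int (\<Sum>n = 1..nat \<lfloor>x\<rfloor>. kronecker D n) \<ge> (dickman B + \<epsilon> q) * x) \<and>
           (dickman B + \<epsilon> q) * x \<ge> c * x)"
    using \<epsilon> pos by (intro exI[of _ \<epsilon>] exI[of _ "dickman B / 2"]) simp
qed

end
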